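(* Let $m\ge1$, $q,q_1,\dots,q_m\in[1,\infty)$ and $\alpha,\alpha_1,\dots,\alpha_m\in\mathbb R$ with $\alpha_i>-n$, such that $\sum_{i=1}^m\frac1{q_i}=\frac1q$ and $\sum_{i=1}^m\frac{\alpha_i}{q_i}=\frac{\alpha}{q}$. Let $\omega_i(x)=|x|_p^{\alpha_i}$, $\omega(x)=|x|_p^{\alpha}$, and assume condition (DK1). Let $\lambda_i\in(-\frac1{q_i},0)$ for $i=1,\dots,m$ and let $\lambda\in\mathbb R$ satisfy $$(\alpha+n)\lambda=(\alpha_1+n)\lambda_1+\cdots+(\alpha_m+n)\lambda_m.$$ Then $\mathcal H^p_{\Phi,\vec A}$ is bounded from $\dot B^{q_1,\lambda_1}_{\omega_1}(\mathbb Q_p^n)\times\cdots\times\dot B^{q_m,\lambda_m}_{\omega_m}(\mathbb Q_p^n)$ to $\dot B^{q,\lambda}_\omega(\mathbb Q_p^n)$ if and only if $$\mathcal C_3=\int_{\mathbb Q_p^n}\frac{\Phi(y)}{|y|_p^n}\prod_{i=1}^m\|A_i^{-1}(y)\|_p^{-(\alpha_i+n)\lambda_i}\,dy<\infty.$$ Moreover, the operator norm is comparable to $\mathcal C_3$ (bounded above and below by constant multiples of $\mathcal C_3$).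
   Context: Let $p$ be a prime, $\mathbb Q_p$ the $p$-adic numbers with absolute value $|\cdot|_p$; for $x\in\mathbb Q_p^n$, $|x|_p=\max_j|x_j|_p$. $dx$ is the Haar measure on $\mathbb Q_p^n$ normalized so that $B_0$ has measure 1, where $B_\gamma=\{x:|x|_p\le p^\gamma\}$, $\gamma\in\mathbb Z$. For an $n\times n$ matrix $A=(a_{ij})$ over $\mathbb Q_p$, $\|A\|_p=\max_{i,j}|a_{ij}|_p$. For a weight $\omega$, $\omega(E)=\int_E\omega$ and $\|f\|_{L^q_\omega(E)}=(\int_E|f|^q\omega)^{1/q}$. Weighted central Morrey space: for $\lambda\in\mathbb R$, $1\le q<\infty$, $\dot B^{q,\lambda}_\omega(\mathbb Q_p^n)$ is the set of $f$ locally in $L^q_\omega$ with $\|f\|_{\dot B^{q,\lambda}_\omega}=\sup_{\gamma\in\mathbb Z}\big(\omega(B_\gamma)^{-1-\lambda q}\int_{B_\gamma}|f|^q\omega\,dx\big)^{1/q}<\infty$. Let $\Phi:\mathbb Q_p^n\to[0,\infty)$ be measurable and $A_1(y),\dots,A_m(y)$ $n\times n$ matrices over $\mathbb Q_p$, measurable in $y$, invertible for a.e. $y$. $\mathcal H^p_{\Phi,\vec A}(\vec f)(x)=\int_{\mathbb Q_p^n}\frac{\Phi(y)}{|y|_p^n}\prod_{i=1}^m f_i(A_i(y)x)\,dy$. Condition (DK1): there is $\nu\in\mathbb N$ with $\|A_i(y)\|_p\|A_i^{-1}(y)\|_p\le p^\nu$ for all $i$ and a.e. $y$. *)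

theory Defs
  imports "HOL-Analysis.Analysis"
begin

text \<open>A field 'k with an absolute value av is (isometrically isomorphic to) Q_p iff:
  av is a non-archimedean absolute value with av p = 1/p, value group p^Z,
  'k is complete for av, and the residue field is F_p (every integral element
  is congruent to one of 0,...,p-1 modulo the maximal ideal).\<close>

definition padic_field :: "nat \<Rightarrow> ('k::field \<Rightarrow> real) \<Rightarrow> bool" where
  "padic_field P av \<longleftrightarrow>
     prime P \<and>
     (\<forall>x. av x \<ge> 0) \<and>
     (\<forall>x. av x = 0 \<longleftrightarrow> x = 0) \<and>
     (\<forall>x y. av (x * y) = av x * av y) \<and>
     (\<forall>x y. av (x + y) \<le> max (av x) (av y)) \<and>
     av (of_nat P) = 1 / real P \<and>
     (\<forall>x. x \<noteq> 0 \<longrightarrow> (\<exists>k::int. av x = real P powr real_of_int k)) \<and>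
     (\<forall>s::nat \<Rightarrow> 'k.
        (\<forall>e>0. \<exists>N. \<forall>a\<ge>N. \<forall>b\<ge>N. av (s a - s b) < e) \<longrightarrow>
        (\<exists>l. \<forall>e>0. \<exists>N. \<forall>k\<ge>N. av (s k - l) < e)) \<and>
     (\<forall>x. av x \<le> 1 \<longrightarrow> (\<exists>j<P. av (x - of_nat j) < 1))"

definition vnorm :: "('k \<Rightarrow> real) \<Rightarrow> 'k ^ 'n \<Rightarrow> real" where
  "vnorm av x = Max (range (\<lambda>j. av (x $ j)))"

definition mnorm :: "('k \<Rightarrow> real) \<Rightarrow> 'k ^ 'n ^ 'n \<Rightarrow> real" where
  "mnorm av A = Max (range (\<lambda>(i, j). av (A $ i $ j)))"

definition pball :: "nat \<Rightarrow> ('k \<Rightarrow> real) \<Rightarrow> ('k::ab_group_add) ^ 'n \<Rightarrow> int \<Rightarrow> ('k ^ 'n) set" where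
  "pball P av c \<gamma> = {x. vnorm av (x - c) \<le> real P powr real_of_int \<gamma>}"

text \<open>Normalised Haar measure on Q_p^n: Borel sets (generated by the balls),
  translation invariant, and B_0 has measure 1.\<close>
definition padic_haar :: "nat \<Rightarrow> ('k::ab_group_add \<Rightarrow> real) \<Rightarrow> ('k ^ 'n) measure \<Rightarrow> bool" where
  "padic_haar P av \<mu> \<longleftrightarrow>
     space \<mu> = UNIV \<and>
     sets \<mu> = sigma_sets UNIV (range (\<lambda>(c, \<gamma>). pball P av c \<gamma>)) \<and>
     (\<forall>A\<in>sets \<mu>. \<forall>a. emeasure \<mu> ((\<lambda>x. a + x) ` A) = emeasure \<mu> A) \<and>
     emeasure \<mu> (pball P av 0 0) = 1"

text \<open>Measurability of a Q_p-valued function w.r.t. the Borel sets of Q_p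
  (generated by the balls of Q_p).\<close>
definition kmeasurable :: "nat \<Rightarrow> ('k::ab_group_add \<Rightarrow> real) \<Rightarrow> 'b measure \<Rightarrow> ('b \<Rightarrow> 'k) \<Rightarrow> bool" where
  "kmeasurable P av M g \<longleftrightarrow>
     (\<forall>c \<gamma>::int. {y \<in> space M. av (g y - c) \<le> real P powr real_of_int \<gamma>} \<in> sets M)"

definition wball :: "nat \<Rightarrow> ('k::ab_group_add \<Rightarrow> real) \<Rightarrow> ('k ^ 'n) measure \<Rightarrow> ('k ^ 'n \<Rightarrow> real)
    \<Rightarrow> int \<Rightarrow> real" where
  "wball P av \<mu> w \<gamma> = enn2real (\<integral>\<^sup>+ x \<in> pball P av 0 \<gamma>. ennreal (w x) \<partial>\<mu>)"

definition lqball :: "nat \<Rightarrow> ('k::ab_group_add \<Rightarrow> real) \<Rightarrow> ('k ^ 'n) measure \<Rightarrow> ('k ^ 'n \<Rightarrow> real)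
    \<Rightarrow> real \<Rightarrow> ('k ^ 'n \<Rightarrow> real) \<Rightarrow> int \<Rightarrow> ennreal" where
  "lqball P av \<mu> w q f \<gamma> = (\<integral>\<^sup>+ x \<in> pball P av 0 \<gamma>. ennreal (\<bar>f x\<bar> powr q * w x) \<partial>\<mu>)"

definition morrey_quot :: "nat \<Rightarrow> ('k::ab_group_add \<Rightarrow> real) \<Rightarrow> ('k ^ 'n) measure \<Rightarrow> ('k ^ 'n \<Rightarrow> real)
    \<Rightarrow> real \<Rightarrow> real \<Rightarrow> ('k ^ 'n \<Rightarrow> real) \<Rightarrow> int \<Rightarrow> real" where
  "morrey_quot P av \<mu> w q l f \<gamma> =
     (wball P av \<mu> w \<gamma> powr (- 1 - l * q) * enn2real (lqball P av \<mu> w q f \<gamma>)) powr (1 / q)"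

definition in_morrey :: "nat \<Rightarrow> ('k::ab_group_add \<Rightarrow> real) \<Rightarrow> ('k ^ 'n) measure \<Rightarrow> ('k ^ 'n \<Rightarrow> real)
    \<Rightarrow> real \<Rightarrow> real \<Rightarrow> ('k ^ 'n \<Rightarrow> real) \<Rightarrow> bool" where
  "in_morrey P av \<mu> w q l f \<longleftrightarrow>
     f \<in> borel_measurable \<mu> \<and>
     (\<forall>\<gamma>. lqball P av \<mu> w q f \<gamma> < \<infinity>) \<and>
     bdd_above (range (morrey_quot P av \<mu> w q l f))"

definition morrey_norm :: "nat \<Rightarrow> ('k::ab_group_add \<Rightarrow> real) \<Rightarrow> ('k ^ 'n) measure \<Rightarrow> ('k ^ 'n \<Rightarrow> real)
    \<Rightarrow> real \<Rightarrow> real \<Rightarrow> ('k ^ 'n \<Rightarrow> real) \<Rightarrow> real" where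
  "morrey_norm P av \<mu> w q l f = (SUP \<gamma>. morrey_quot P av \<mu> w q l f \<gamma>)"

definition hkernel :: "('k::field \<Rightarrow> real) \<Rightarrow> ('k ^ 'n \<Rightarrow> real) \<Rightarrow> nat \<Rightarrow> (nat \<Rightarrow> 'k ^ 'n \<Rightarrow> 'k ^ 'n ^ 'n)
    \<Rightarrow> (nat \<Rightarrow> 'k ^ 'n \<Rightarrow> real) \<Rightarrow> 'k ^ 'n \<Rightarrow> 'k ^ 'n \<Rightarrow> real" where
  "hkernel av \<Phi> m A f x y =
     \<Phi> y / vnorm av y ^ CARD('n) * (\<Prod>i<m. f i (A i y *v x))"

definition hausdorff_op :: "('k::field \<Rightarrow> real) \<Rightarrow> ('k ^ 'n) measure \<Rightarrow> ('k ^ 'n \<Rightarrow> real) \<Rightarrow> nat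
    \<Rightarrow> (nat \<Rightarrow> 'k ^ 'n \<Rightarrow> 'k ^ 'n ^ 'n) \<Rightarrow> (nat \<Rightarrow> 'k ^ 'n \<Rightarrow> real) \<Rightarrow> 'k ^ 'n \<Rightarrow> real" where
  "hausdorff_op av \<mu> \<Phi> m A f x = (\<integral> y. hkernel av \<Phi> m A f x y \<partial>\<mu>)"

definition hbound :: "nat \<Rightarrow> ('k::field \<Rightarrow> real) \<Rightarrow> ('k ^ 'n) measure \<Rightarrow> ('k ^ 'n \<Rightarrow> real) \<Rightarrow> nat
    \<Rightarrow> (nat \<Rightarrow> 'k ^ 'n \<Rightarrow> 'k ^ 'n ^ 'n)
    \<Rightarrow> (nat \<Rightarrow> 'k ^ 'n \<Rightarrow> real) \<Rightarrow> (nat \<Rightarrow> real) \<Rightarrow> (nat \<Rightarrow> real)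
    \<Rightarrow> ('k ^ 'n \<Rightarrow> real) \<Rightarrow> real \<Rightarrow> real \<Rightarrow> real \<Rightarrow> bool" where
  "hbound P av \<mu> \<Phi> m A ws qs ls w q l C \<longleftrightarrow>
     C \<ge> 0 \<and>
     (\<forall>f. (\<forall>i<m. in_morrey P av \<mu> (ws i) (qs i) (ls i) (f i)) \<longrightarrow>
        (AE x in \<mu>. integrable \<mu> (hkernel av \<Phi> m A f x)) \<and>
        in_morrey P av \<mu> w q l (hausdorff_op av \<mu> \<Phi> m A f) \<and>
        morrey_norm P av \<mu> w q l (hausdorff_op av \<mu> \<Phi> m A f)
          \<le> C * (\<Prod>i<m. morrey_norm P av \<mu> (ws i) (qs i) (ls i) (f i)))"

definition hbounded where
  "hbounded P av \<mu> \<Phi> m A ws qs ls w q l \<longleftrightarrow> (\<exists>C. hbound P av \<mu> \<Phi> m A ws qs ls w q l C)"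

definition hopnorm where
  "hopnorm P av \<mu> \<Phi> m A ws qs ls w q l = Inf {C. hbound P av \<mu> \<Phi> m A ws qs ls w q l C}"

end

theory Submission
  imports Defs
begin

text \<open>
  By (DK1), \<open>\<parallel>A\<^sub>i\<^sup>-\<^sup>1\<parallel>\<close> is comparable to \<open>1/\<parallel>A\<^sub>i\<parallel>\<close>, so an invertible substitution distorts power weights and
  balls by controlled powers of \<open>\<parallel>A\<^sub>i\<parallel>\<close>; no determinants are needed, because uniqueness of Haar measure gives
  \<open>\<mu>(A\<^sup>-\<^sup>1E) = \<mu>(A\<^sup>-\<^sup>1B\<^sub>0) \<mu>(E)\<close> and \<open>A\<^sup>-\<^sup>1B\<^sub>0\<close> lies in the ball of radius \<open>\<parallel>A\<^sup>-\<^sup>1\<parallel>\<close>. For the upper bound, Minkowski's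
  integral inequality is replaced by Jensen's inequality for the measure \<open>kern(y) dy\<close>, where \<open>kern\<close> is the
  integrand of \<open>C\<^sub>3\<close> with \<open>\<parallel>A\<^sub>i\<^sup>-\<^sup>1\<parallel>\<close> replaced by \<open>1/\<parallel>A\<^sub>i\<parallel>\<close>, applied to the correspondingly normalised product of
  the \<open>f\<^sub>i(A\<^sub>i(y)x)\<close>, whose local \<open>L\<^sup>q\<close> norms are bounded uniformly in \<open>y\<close> by Hoelder's inequality. For the lower
  bound, test with \<open>f\<^sub>i(x) = \<bar>x\<bar>\<close> to the power \<open>(\<alpha>\<^sub>i + n)\<lambda>\<^sub>i\<close>: this exponent is negative, so \<open>\<bar>A\<^sub>ix\<bar> \<le> \<parallel>A\<^sub>i\<parallel>\<bar>x\<bar>\<close> bounds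
  \<open>f\<^sub>i(A\<^sub>ix)\<close> from below.
\<close>

section \<open>The field of p-adic numbers and its vector spaces\<close>

text \<open>One scaling computation fixes the form of everything. Up to constants, replacing f_i(x)
  by f_i(A_i x) multiplies its Morrey bound by the norm of A_i to the power \<open>expo i\<close> =
  (\<alpha>_i + n)\<lambda>_i, and the relation between \<lambda> and the \<lambda>_i makes the
  remaining powers of the radius agree with those of the target space. Dividing these factors out
  leaves local bounds independent of y; what is divided out forms the density \<open>kern\<close>,
  whose total mass is therefore the natural size of the operator. The constants must precede \<Phi>
  and the A_i in the quantifier order, so they are built from the exponents, p, \<nu> and n before
  any kernel is introduced. Two obstacles concern measurability. The field carries no topology, so
  measurability of sums, products and matrix action, jointly in (x, y) as Fubini's theorem demands,
  is derived from balls and a countable dense set. And the integrand of C_3 contains inverse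
  matrices, whose measurability is not established; it is therefore only compared with
  \<open>kern\<close> by inequalities valid almost everywhere.\<close>

locale padic =
  fixes P :: nat and av :: "'k::field \<Rightarrow> real"
  assumes padic_field: "padic_field P av"
begin

lemma prime_P: "prime P"
  and av_nonneg [simp]: "av x \<ge> 0"
  and av_eq_0_iff [simp]: "av x = 0 \<longleftrightarrow> x = 0"
  and av_mult: "av (x * y) = av x * av y"
  and av_add: "av (x + y) \<le> max (av x) (av y)"
  and av_P: "av (of_nat P) = 1 / real P"
  and av_value: "x \<noteq> 0 \<Longrightarrow> \<exists>k::int. av x = real P powr real_of_int k"
  and av_residue: "av x \<le> 1 \<Longrightarrow> \<exists>j<P. av (x - of_nat j) < 1"
  using padic_field unfolding padic_field_def by simp_all

abbreviation ppow :: "int \<Rightarrow> real" where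
  "ppow k \<equiv> real P powr real_of_int k"

lemma P_gt_1: "real P > 1"
  using prime_gt_1_nat[OF prime_P] by simp

lemma ppow_pos [simp]: "ppow k > 0"
  using P_gt_1 by simp

lemma ppow_le_iff [simp]: "ppow j \<le> ppow k \<longleftrightarrow> j \<le> k"
  using P_gt_1 by simp

lemma ppow_eq_iff: "ppow j = ppow k \<longleftrightarrow> j = k"
  by (metis order_antisym order_refl ppow_le_iff)

lemma ppow_less_iff [simp]: "ppow j < ppow k \<longleftrightarrow> j < k"
  using P_gt_1 by simp

lemma ppow_add: "ppow (j + k) = ppow j * ppow k"
  by (simp add: powr_add)

lemma ppow_cancel: "ppow k * ppow (- k) = 1" "ppow (- k) * ppow k = 1"
  using P_gt_1 by (simp_all add: powr_minus)

lemma av_1 [simp]: "av 1 = 1"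
  using av_mult[of 1 1] av_eq_0_iff[of 1] by simp

lemma av_0 [simp]: "av 0 = 0"
  by simp

lemma av_minus [simp]: "av (- x) = av x"
proof -
  have "av (-1) * av (-1) = 1"
    using av_mult[of "-1" "-1"] by simp
  then have "av (-1) = 1"
    using av_nonneg[of "-1"] by (simp add: square_eq_1_iff)
  then show ?thesis
    using av_mult[of "-1" x] by simp
qed

lemma av_diff: "av (x - y) \<le> max (av x) (av y)"
  using av_add[of x "- y"] by simp

lemma av_diff_commute: "av (x - y) = av (y - x)"
  using av_minus[of "x - y"] by simp

text \<open>The value group is discrete, so a strict bound by a power of p is a weak bound by the
  preceding power. Its vector version turns spheres into differences of balls.\<close>

lemma av_less_ppow_iff: "av x < ppow k \<longleftrightarrow> av x \<le> ppow (k - 1)"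
proof (cases "x = 0")
  case False
  then show ?thesis
    using av_value[OF False] by (auto simp del: of_int_diff)
next
  case True
  then show ?thesis
    using ppow_pos[of k] ppow_pos[of "k - 1"] by (metis av_eq_0_iff less_imp_le)
qed

lemma ex_ppow_less: "e > 0 \<Longrightarrow> \<exists>k. ppow k < e"
proof -
  assume e: "e > 0"
  have "ppow (\<lceil>log P e\<rceil> - 1) < P powr (log P e)"
    using P_gt_1 by (intro powr_less_mono) linarith+
  then show ?thesis
    using e P_gt_1 by (intro exI[of _ "\<lceil>log P e\<rceil> - 1"]) simp
qed

lemma ex_ppow_ge: "\<exists>k\<ge>j. e \<le> ppow k"
proof (cases "e > 0")
  case True
  have "P powr (log P e) \<le> ppow (max j \<lceil>log P e\<rceil>)"
    using P_gt_1 by (intro powr_mono) linarith+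
  then show ?thesis
    using True P_gt_1 by (intro exI[of _ "max j \<lceil>log P e\<rceil>"]) auto
next
  case False
  then show ?thesis
    using ppow_pos[of j] by (intro exI[of _ j]) linarith
qed

section \<open>Integers in the field and elements of prescribed absolute value\<close>

lemma av_of_nat_le_1: "av (of_nat j) \<le> 1"
proof (induction j)
  case (Suc j)
  then show ?case
    using av_add[of "of_nat j" 1] by (simp add: add.commute)
qed simp

lemma av_of_int_le_1: "av (of_int j) \<le> 1"
  using av_of_nat_le_1 by (cases j rule: int_cases2) auto

text \<open>If |j| were below 1, a Bezout identity a j + b P = 1 would write 1 as a sum of two terms
  of absolute value below 1.\<close>

lemma av_of_nat_unit:
  assumes "0 < j" "j < P"
  shows "av (of_nat j) = 1"
proof (rule ccontr)
  assume "av (of_nat j) \<noteq> 1"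
  then have small: "av (of_nat j) < 1"
    using av_of_nat_le_1[of j] by simp
  have "\<not> P dvd j"
    using assms by (meson nat_dvd_not_less)
  then have "coprime P j"
    using prime_P prime_imp_coprime by blast
  then have gcd: "gcd (int j) (int P) = 1"
    by (simp add: gcd.commute)
  obtain a b where ab: "a * int j + b * int P = 1"
    using bezout_int[of "int j" "int P"] gcd by metis
  have eq: "(1::'k) = of_int a * of_nat j + of_int b * of_nat P"
    using arg_cong[OF ab, of of_int] by simp
  have le: "av (of_int c) * r \<le> r" if "r \<ge> 0" for c r
    using mult_right_mono[OF av_of_int_le_1[of c] that] by simp
  have "av (of_int a * of_nat j) < 1"
    using small le[of "av (of_nat j)" a] unfolding av_mult by simp
  moreover have "av (of_int b * of_nat P) < 1"
    using P_gt_1 le[of "1 / real P" b] unfolding av_mult av_P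
    by (rule_tac le_less_trans[of _ "1 / real P"]) simp_all
  ultimately show False
    using av_add[of "of_int a * of_nat j" "of_int b * of_nat P"] unfolding eq[symmetric] by simp
qed

lemma av_of_nat_diff:
  assumes "i < P" "j < P" "i \<noteq> j"
  shows "av (of_nat i - of_nat j) = 1"
proof -
  have "av (of_nat a - of_nat b) = 1" if "b < a" "a < P" for a b
    using that av_of_nat_unit[of "a - b"] by (simp add: of_nat_diff)
  then show ?thesis
    using assms by (metis av_diff_commute linorder_neqE_nat)
qed

text \<open>The exponent is that of the absolute value, hence the sign.\<close>

definition unif :: "int \<Rightarrow> 'k" where
  "unif k = (if k \<ge> 0 then inverse (of_nat P ^ nat k) else of_nat P ^ nat (- k))"

lemma av_power: "av (x ^ j) = av x ^ j"
  by (induction j) (simp_all add: av_mult)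

lemma av_inverse: "av (inverse x) = inverse (av x)"
proof (cases "x = 0")
  case False
  then have "av x * av (inverse x) = 1"
    by (simp flip: av_mult)
  then show ?thesis
    by (simp add: inverse_unique)
qed simp

lemma av_unif: "av (unif k) = ppow k"
proof (cases "k \<ge> 0")
  case True
  then have "ppow k = real P ^ nat k"
    using P_gt_1 by (simp flip: powr_realpow)
  then show ?thesis
    using True by (simp add: unif_def av_inverse av_power av_P power_one_over)
next
  case False
  then have "ppow k = inverse (real P powr (real (nat (- k))))"
    by (simp flip: powr_minus)
  also have "\<dots> = inverse (real P ^ nat (- k))"
    using P_gt_1 by (subst powr_realpow) auto
  finally show ?thesis
    using False by (simp add: unif_def av_power av_P power_one_over inverse_eq_divide)
qed

lemma unif_nonzero [simp]: "unif k \<noteq> 0"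
  using av_unif[of k] ppow_pos[of k] by (metis av_0 less_irrefl)

section \<open>A countable dense set of scalars\<close>

definition pdense :: "'k set" where
  "pdense = range (\<lambda>(j, k). of_nat j * unif k)"

lemma countable_pdense: "countable pdense"
  by (simp add: pdense_def)

text \<open>The p-adic expansion, digit by digit: the error after \<open>e\<close> digits, divided
  by P^e, is integral, and its residue class supplies the next digit.\<close>

lemma nat_approx:
  assumes "av x \<le> 1"
  shows "\<exists>j. av (x - of_nat j) \<le> ppow (- int e)"
proof (induction e)
  case 0
  then show ?case
    using assms P_gt_1 by (intro exI[of _ 0]) simp
next
  case (Suc e)
  then obtain j where j: "av (x - of_nat j) \<le> ppow (- int e)"
    by blast
  have P0: "of_nat P \<noteq> (0::'k)"
    using av_P P_gt_1 by (metis av_0 divide_eq_0_iff not_one_less_zero zero_neq_one less_irrefl)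
  \<comment> \<open>In the sign convention of \<open>unif\<close>, multiplying by
    \<open>unif (int e)\<close> is dividing by P^e.\<close>
  define u where "u = (x - of_nat j) * unif (int e)"
  have "av u \<le> ppow (- int e) * ppow (int e)"
    unfolding u_def av_mult av_unif using j by (intro mult_right_mono) auto
  then have "av u \<le> 1"
    by (simp only: ppow_cancel)
  then obtain i where i: "av (u - of_nat i) < 1"
    using av_residue by blast
  then have "av (u - of_nat i) < ppow 0"
    using P_gt_1 by simp
  then have i': "av (u - of_nat i) \<le> ppow (-1)"
    by (simp only: av_less_ppow_iff) simp
  have "unif (- int e) = of_nat P ^ e" "unif (int e) * unif (- int e) = 1"
    using P0 by (cases "e = 0"; simp add: unif_def)+
  then have "x - of_nat (j + i * P ^ e) = (u - of_nat i) * unif (- int e)"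
    by (simp add: u_def left_diff_distrib mult.assoc)
  then have "av (x - of_nat (j + i * P ^ e)) \<le> ppow (-1) * ppow (- int e)"
    using i' by (simp only: av_mult av_unif) (intro mult_right_mono, auto)
  then show ?case
    unfolding ppow_add[symmetric] by (intro exI[of _ "j + i * P ^ e"]) simp
qed

text \<open>Scaling by \<open>unif (- g)\<close> brings x into the unit ball, where natural numbers
  approximate; precision k there becomes precision k - g.\<close>

lemma pdense_approx: "\<exists>d\<in>pdense. av (x - d) \<le> ppow k"
proof -
  obtain g where g: "g \<ge> k" "av x \<le> ppow g"
    using ex_ppow_ge by blast
  have "av (x * unif (- g)) \<le> ppow g * ppow (- g)"
    unfolding av_mult av_unif using g by (intro mult_right_mono) auto
  then have "av (x * unif (- g)) \<le> 1"
    by (simp only: ppow_cancel)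
  then obtain j where "av (x * unif (- g) - of_nat j) \<le> ppow (- int (nat (g - k)))"
    using nat_approx by blast
  then have j: "av (x * unif (- g) - of_nat j) \<le> ppow (k - g)"
    using g by simp
  have "unif (- g) * unif g = 1"
    using P_gt_1 av_unif[of 1] unif_nonzero[of g] unif_nonzero[of "-g"]
    by (auto simp: unif_def split: if_splits)
  then have "x - of_nat j * unif g = (x * unif (- g) - of_nat j) * unif g"
    by (simp add: algebra_simps)
  then have "av (x - of_nat j * unif g) \<le> ppow (k - g) * ppow g"
    using j by (simp only: av_mult av_unif) (intro mult_right_mono, auto)
  then have "av (x - of_nat j * unif g) \<le> ppow k"
    by (simp flip: powr_add)
  then show ?thesis
    by (auto simp: pdense_def)
qed

section \<open>Maximum norms of vectors and matrices\<close>

lemma vnorm_le_iff: "vnorm av (x :: 'k^'n) \<le> r \<longleftrightarrow> (\<forall>i. av (x $ i) \<le> r)"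
  by (auto simp: vnorm_def)

lemma vnorm_attained: "\<exists>i. vnorm av (x :: 'k^'n) = av (x $ i)"
proof -
  have "vnorm av x \<in> range (\<lambda>i. av (x $ i))"
    unfolding vnorm_def by (intro Max_in) auto
  then show ?thesis
    by auto
qed

lemma av_le_vnorm: "av (x $ i) \<le> vnorm av (x :: 'k^'n)"
  using vnorm_le_iff by blast

lemma vnorm_nonneg [simp]: "vnorm av (x :: 'k^'n) \<ge> 0"
  using vnorm_attained[of x] by auto

lemma vnorm_eq_0_iff [simp]: "vnorm av (x :: 'k^'n) = 0 \<longleftrightarrow> x = 0"
proof
  assume "vnorm av x = 0"
  then have "\<forall>i. av (x $ i) \<le> 0"
    using vnorm_le_iff[of x 0] by simp
  then show "x = 0"
    by (metis antisym av_eq_0_iff av_nonneg vec_eq_iff zero_index)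
next
  assume "x = 0"
  then show "vnorm av x = 0"
    using vnorm_attained[of x] by auto
qed

lemma vnorm_0 [simp]: "vnorm av (0 :: 'k^'n) = 0"
  by simp

lemma vnorm_pos: "x \<noteq> 0 \<Longrightarrow> vnorm av (x :: 'k^'n) > 0"
  using vnorm_nonneg[of x] vnorm_eq_0_iff[of x] by linarith

lemma vnorm_add: "vnorm av (x + y :: 'k^'n) \<le> max (vnorm av x) (vnorm av y)"
  unfolding vnorm_le_iff
proof
  fix i
  show "av ((x + y) $ i) \<le> max (vnorm av x) (vnorm av y)"
    using av_add[of "x $ i" "y $ i"] av_le_vnorm[of x i] av_le_vnorm[of y i] by auto
qed

lemma vnorm_minus [simp]: "vnorm av (- x :: 'k^'n) = vnorm av x"
  by (simp add: vnorm_def)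

lemma vnorm_diff_commute: "vnorm av (x - y :: 'k^'n) = vnorm av (y - x)"
  using vnorm_minus[of "x - y"] by simp

lemma vnorm_value: "x \<noteq> 0 \<Longrightarrow> \<exists>k. vnorm av (x :: 'k^'n) = ppow k"
  using vnorm_attained[of x] vnorm_eq_0_iff[of x] av_value by (metis av_eq_0_iff)

lemma vnorm_less_ppow_iff: "vnorm av (x :: 'k^'n) < ppow k \<longleftrightarrow> vnorm av x \<le> ppow (k - 1)"
  using vnorm_attained[of x] av_less_ppow_iff by metis

lemma av_sum:
  assumes "finite I" "\<And>i. i \<in> I \<Longrightarrow> av (f i) \<le> r" "r \<ge> 0"
  shows "av (sum f I) \<le> r"
  using assms
proof (induction I)
  case (insert i I)
  then have "av (f i) \<le> r" "av (sum f I) \<le> r"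
    by auto
  then show ?case
    using av_add[of "f i" "sum f I"] insert.hyps by simp
qed simp

lemma av_le_mnorm: "av (A $ i $ j) \<le> mnorm av (A :: 'k^'n^'n)"
proof -
  have "finite (range (\<lambda>(i, j). av (A $ i $ j)))"
    by simp
  moreover have "av (A $ i $ j) \<in> range (\<lambda>(i, j). av (A $ i $ j))"
    by (metis case_prod_conv rangeI)
  ultimately show ?thesis
    unfolding mnorm_def by (rule Max_ge)
qed

lemma mnorm_attained: "\<exists>i j. mnorm av (A :: 'k^'n^'n) = av (A $ i $ j)"
proof -
  have "mnorm av A \<in> range (\<lambda>(i, j). av (A $ i $ j))"
    unfolding mnorm_def by (intro Max_in) auto
  then show ?thesis
    by auto
qed

lemma mnorm_nonneg [simp]: "mnorm av (A :: 'k^'n^'n) \<ge> 0"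
  using mnorm_attained[of A] by auto

lemma vnorm_mult_vec: "vnorm av (A *v x) \<le> mnorm av A * vnorm av (x :: 'k^'n)"
  unfolding vnorm_le_iff
proof
  fix i
  show "av ((A *v x) $ i) \<le> mnorm av A * vnorm av x"
    by (auto simp: matrix_vector_mult_def av_mult intro!: av_sum mult_mono av_le_mnorm av_le_vnorm)
qed

lemma mnorm_value:
  assumes "mnorm av (A :: 'k^'n^'n) \<noteq> 0"
  shows "\<exists>k. mnorm av A = ppow k"
  using mnorm_attained[of A] assms av_value by (metis av_eq_0_iff)

lemma matrix_inv_vec:
  assumes "invertible (A :: 'k^'n^'n)"
  shows "matrix_inv A *v (A *v x) = x" "A *v (matrix_inv A *v x) = x"
proof -
  have "\<exists>B. A ** B = mat 1 \<and> B ** A = mat 1"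
    using assms by (simp add: invertible_def)
  then have "A ** matrix_inv A = mat 1 \<and> matrix_inv A ** A = mat 1"
    unfolding matrix_inv_def by (rule someI_ex)
  then show "matrix_inv A *v (A *v x) = x" "A *v (matrix_inv A *v x) = x"
    by (simp_all add: matrix_vector_mul_assoc)
qed

text \<open>The product of inverse and matrix fixes the all-ones vector, whose norm is nonzero.
  Together with (DK1) this places the norm of the inverse between 1/a and P^\<nu>/a, where a is the
  norm of A.\<close>

lemma mnorm_matrix_inv:
  assumes "invertible (A :: 'k^'n^'n)"
  shows "1 \<le> mnorm av (matrix_inv A) * mnorm av A"
proof -
  have pos: "vnorm av (1 :: 'k^'n) > 0"
    by (intro vnorm_pos) simp
  have "vnorm av (1 :: 'k^'n) \<le> mnorm av (matrix_inv A) * vnorm av (A *v (1 :: 'k^'n))"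
    using vnorm_mult_vec[of "matrix_inv A" "A *v 1"] assms by (simp add: matrix_inv_vec)
  also have "\<dots> \<le> mnorm av (matrix_inv A) * (mnorm av A * vnorm av (1 :: 'k^'n))"
    by (intro mult_left_mono vnorm_mult_vec) simp
  finally show ?thesis
    using pos by (simp flip: mult.assoc)
qed

section \<open>Ultrametric balls\<close>

lemma mem_pball: "x \<in> pball P av (c :: 'k^'n) k \<longleftrightarrow> vnorm av (x - c) \<le> ppow k"
  by (simp add: pball_def)

lemma vnorm_triangle:
  "vnorm av (x - y :: 'k^'n) \<le> r \<Longrightarrow> vnorm av (y - z) \<le> r \<Longrightarrow> vnorm av (x - z) \<le> r"
  using vnorm_add[of "x - y" "y - z"] by simp

lemma pball_recenter:
  assumes "d \<in> pball P av (c :: 'k^'n) k"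
  shows "pball P av c k = pball P av d k"
  using assms vnorm_triangle[of _ c "ppow k" d] vnorm_triangle[of _ d "ppow k" c]
    vnorm_diff_commute[of c d] by (auto simp: mem_pball)

lemma pball_mono: "j \<le> k \<Longrightarrow> pball P av (c :: 'k^'n) j \<subseteq> pball P av c k"
  using order_trans[of _ "ppow j" "ppow k"] by (auto simp: mem_pball)

lemma center_in_pball [simp]: "c \<in> pball P av (c :: 'k^'n) k"
proof -
  have "vnorm av (0 :: 'k^'n) = 0" by simp
  then show ?thesis using ppow_pos[of k] by (simp add: mem_pball del: vnorm_eq_0_iff)
qed

text \<open>Any common point is a centre of both balls, so two balls are nested or disjoint; the
  empty set is added for the disjoint case. This makes the balls a class on which measures can be
  compared.\<close>

lemma Int_stable_pballs:
  "Int_stable (insert {} (range (\<lambda>(c :: 'k^'n, k). pball P av c k)))"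
proof -
  have *: "pball P av c j \<inter> pball P av d k \<in> insert {} (range (\<lambda>(c :: 'k^'n, k). pball P av c k))"
    if "j \<le> k" for c d :: "'k^'n" and j k
  proof (cases "pball P av c j \<inter> pball P av d k = {}")
    case False
    then obtain x where "x \<in> pball P av c j" "x \<in> pball P av d k"
      by blast
    then have "pball P av c j \<inter> pball P av d k = pball P av x j"
      using pball_recenter pball_mono[OF that, of x] by auto
    then show ?thesis
      by (auto intro!: image_eqI[of _ _ "(x, j)"])
  qed simp
  have "pball P av c j \<inter> pball P av d k \<in> insert {} (range (\<lambda>(c :: 'k^'n, k). pball P av c k))"
    for c d :: "'k^'n" and j k
    using *[of j k c d] *[of k j d c] by (metis Int_commute linear)
  then show ?thesis
    unfolding Int_stable_def by auto
qed

definition vdense :: "('k^'n) set" where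
  "vdense = {x. \<forall>i. x $ i \<in> pdense}"

lemma countable_vdense: "countable (vdense :: ('k^'n) set)"
proof (rule countable_image_inj_on[where f = vec_nth])
  have "countable (PiE (UNIV :: 'n set) (\<lambda>_. pdense))"
    by (intro countable_PiE countable_pdense) simp
  moreover have "vec_nth ` (vdense :: ('k^'n) set) \<subseteq> PiE UNIV (\<lambda>_. pdense)"
    by (auto simp: vdense_def)
  ultimately show "countable (vec_nth ` (vdense :: ('k^'n) set))"
    by (rule countable_subset[rotated])
  show "inj_on vec_nth (vdense :: ('k^'n) set)"
    by (simp add: inj_on_def vec_nth_inject)
qed

lemma vdense_approx: "\<exists>d\<in>vdense. x \<in> pball P av (d :: 'k^'n) k"
proof -
  have "\<forall>i. \<exists>d. d \<in> pdense \<and> av (x $ i - d) \<le> ppow k"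
    using pdense_approx by blast
  then obtain d where "\<forall>i. d i \<in> pdense \<and> av (x $ i - d i) \<le> ppow k"
    by metis
  then show ?thesis
    by (intro bexI[of _ "\<chi> i. d i"]) (auto simp: mem_pball vnorm_le_iff vdense_def)
qed

end

section \<open>Borel sets and Haar measure\<close>

text \<open>Stated for arbitrary measures because it is applied to the pushforward of \<mu> under a
  matrix as well as to \<mu>.\<close>

definition translation_invariant :: "('a::ab_group_add) measure \<Rightarrow> bool" where
  "translation_invariant M \<longleftrightarrow> (\<forall>A\<in>sets M. \<forall>a. emeasure M ((\<lambda>x. a + x) ` A) = emeasure M A)"

context padic
begin

section \<open>Borel sets of scalars and vectors\<close>

definition kborel :: "'k measure" where
  "kborel = sigma UNIV (range (\<lambda>(c, k). {x. av (x - c) \<le> ppow k}))"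

definition vborel :: "('k^'n) measure" where
  "vborel = sigma UNIV (range (\<lambda>(c, k). pball P av c k))"

lemma space_kborel [simp]: "space kborel = UNIV"
  by (simp add: kborel_def)

lemma space_vborel [simp]: "space vborel = UNIV"
  by (simp add: vborel_def)

lemma sets_vborel: "sets vborel = sigma_sets UNIV (range (\<lambda>(c :: 'k^'n, k). pball P av c k))"
  by (simp add: vborel_def)

lemma ball_in_kborel: "{x. av (x - c) \<le> ppow k} \<in> sets kborel"
proof -
  have "{x. av (x - c) \<le> ppow k} \<in> range (\<lambda>(c, k). {x. av (x - c) \<le> ppow k})"
    using rangeI[of "\<lambda>(c, k). {x. av (x - c) \<le> ppow k}" "(c, k)"] by simp
  then show ?thesis
    by (simp add: kborel_def sigma_sets.Basic)
qed

lemma pball_in_vborel [measurable]: "pball P av c k \<in> sets (vborel :: ('k^'n) measure)"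
proof -
  have "pball P av c k \<in> range (\<lambda>(c :: 'k^'n, k). pball P av c k)"
    using rangeI[of "\<lambda>(c :: 'k^'n, k). pball P av c k" "(c, k)"] by simp
  then show ?thesis
    by (simp add: sets_vborel sigma_sets.Basic)
qed

lemma kmeasurable_iff: "kmeasurable P av M g \<longleftrightarrow> g \<in> measurable M kborel"
proof -
  have eq: "g -` {x. av (x - c) \<le> r} \<inter> space M = {y \<in> space M. av (g y - c) \<le> r}" for c r
    by auto
  show ?thesis
  proof
    assume g: "kmeasurable P av M g"
    show "g \<in> measurable M kborel"
      unfolding kborel_def
    proof (rule measurable_measure_of)
      fix A assume "A \<in> range (\<lambda>(c, k). {x. av (x - c) \<le> ppow k})"
      then obtain c k where "A = {x. av (x - c) \<le> ppow k}"
        by force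
      then show "g -` A \<inter> space M \<in> sets M"
        using g unfolding kmeasurable_def eq[symmetric] by blast
    qed auto
  next
    assume g: "g \<in> measurable M kborel"
    show "kmeasurable P av M g"
      unfolding kmeasurable_def eq[symmetric] using measurable_sets[OF g ball_in_kborel] by blast
  qed
qed

text \<open>Second countability made explicit: an open subset of the product is the union of the
  boxes with centres in \<open>pdense\<close> that it contains, and there are countably many of
  those.\<close>

lemma open_in_kborel_pair:
  assumes "\<And>x y. (x, y) \<in> S \<Longrightarrow>
    \<exists>k. \<forall>x' y'. av (x' - x) \<le> ppow k \<longrightarrow> av (y' - y) \<le> ppow k \<longrightarrow> (x', y') \<in> S"
  shows "S \<in> sets (kborel \<Otimes>\<^sub>M kborel)"
proof -
  define B where "B d k = {x. av (x - d) \<le> ppow k}" for d k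
  define I where "I = {(d, e, k). d \<in> pdense \<and> e \<in> pdense \<and> B d k \<times> B e k \<subseteq> S}"
  have "countable (pdense \<times> pdense \<times> (UNIV :: int set))"
    by (intro countable_SIGMA countable_pdense) auto
  then have cI: "countable I"
    by (rule countable_subset[rotated]) (auto simp: I_def)
  have S_eq: "S = (\<Union>(d, e, k)\<in>I. B d k \<times> B e k)"
  proof (intro subset_antisym subsetI)
    fix p assume p: "p \<in> S"
    obtain x y where xy: "p = (x, y)"
      by force
    obtain k where k: "\<And>x' y'. av (x' - x) \<le> ppow k \<Longrightarrow> av (y' - y) \<le> ppow k \<Longrightarrow> (x', y') \<in> S"
      using assms[of x y] p unfolding xy by blast
    obtain d e where de: "d \<in> pdense" "av (x - d) \<le> ppow k" "e \<in> pdense" "av (y - e) \<le> ppow k"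
      using pdense_approx[of x k] pdense_approx[of y k] by blast
    have tri: "av (x' - x) \<le> ppow k" if "av (x' - d) \<le> ppow k" "av (x - d) \<le> ppow k" for x' x d
      using av_diff[of "x' - d" "x - d"] that by simp
    \<comment> \<open>Recentring a ball at one of its points does not change it, so the box about
      (d, e) is the box about (x, y).\<close>
    have "B d k \<times> B e k \<subseteq> S"
    proof clarify
      fix x' y' assume "x' \<in> B d k" "y' \<in> B e k"
      then show "(x', y') \<in> S"
        using k[OF tri[of x' d x] tri[of y' e y]] de by (simp add: B_def)
    qed
    then have "(d, e, k) \<in> I"
      using de by (simp add: I_def)
    moreover have "p \<in> B d k \<times> B e k"
      using de by (simp add: B_def xy)
    ultimately show "p \<in> (\<Union>(d, e, k)\<in>I. B d k \<times> B e k)"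
      by (intro UN_I[of "(d, e, k)"]) simp_all
  next
    fix p assume "p \<in> (\<Union>(d, e, k)\<in>I. B d k \<times> B e k)"
    then show "p \<in> S"
      unfolding I_def by blast
  qed
  have "(case t of (d, e, k) \<Rightarrow> B d k \<times> B e k) \<in> sets (kborel \<Otimes>\<^sub>M kborel)" for t
    by (cases t) (simp add: B_def ball_in_kborel pair_measureI)
  then show ?thesis
    by (subst S_eq) (rule sets.countable_UN''[OF cI])
qed

text \<open>Continuity makes preimages of balls open, since a ball containing \<open>f x y\<close>
  can be recentred there.\<close>

lemma measurable_into_kborel_pair:
  fixes f :: "'k \<Rightarrow> 'k \<Rightarrow> 'k"
  assumes "\<And>x y k. \<exists>j. \<forall>x' y'. av (x' - x) \<le> ppow j \<longrightarrow> av (y' - y) \<le> ppow j \<longrightarrow>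
    av (f x' y' - f x y) \<le> ppow k"
  shows "case_prod f \<in> measurable (kborel \<Otimes>\<^sub>M kborel) kborel"
  unfolding kborel_def
proof (rule measurable_measure_of, unfold kborel_def[symmetric])
  fix A assume "A \<in> range (\<lambda>(c, k). {x. av (x - c) \<le> ppow k})"
  then obtain c k where A: "A = {x. av (x - c) \<le> ppow k}"
    by auto
  have "case_prod f -` A \<in> sets (kborel \<Otimes>\<^sub>M kborel)"
  proof (rule open_in_kborel_pair)
    fix x y assume "(x, y) \<in> case_prod f -` A"
    then have xy: "av (f x y - c) \<le> ppow k"
      by (simp add: A)
    have tri: "av (z - c) \<le> ppow k" if "av (z - f x y) \<le> ppow k" for z
      using av_add[of "z - f x y" "f x y - c"] that xy by simp
    then show "\<exists>j. \<forall>x' y'. av (x' - x) \<le> ppow j \<longrightarrow> av (y' - y) \<le> ppow j \<longrightarrow>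
        (x', y') \<in> case_prod f -` A"
      using assms[of x y k] by (simp add: A) blast
  qed
  then show "case_prod f -` A \<inter> space (kborel \<Otimes>\<^sub>M kborel) \<in> sets (kborel \<Otimes>\<^sub>M kborel)"
    by (simp add: space_pair_measure)
qed auto

lemma kborel_add [measurable]:
  assumes "f \<in> measurable M kborel" "g \<in> measurable M kborel"
  shows "(\<lambda>x. f x + g x) \<in> measurable M kborel"
proof -
  have "case_prod (+) \<in> measurable (kborel \<Otimes>\<^sub>M kborel) kborel"
  proof (rule measurable_into_kborel_pair)
    fix x y k
    have "av (x' + y' - (x + y)) \<le> ppow k" if "av (x' - x) \<le> ppow k" "av (y' - y) \<le> ppow k" for x' y'
      using av_add[of "x' - x" "y' - y"] that by (simp add: algebra_simps)
    then show "\<exists>j. \<forall>x' y'. av (x' - x) \<le> ppow j \<longrightarrow> av (y' - y) \<le> ppow j \<longrightarrow>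
        av (x' + y' - (x + y)) \<le> ppow k"
      by blast
  qed
  from measurable_compose[OF measurable_Pair[OF assms] this] show ?thesis
    by simp
qed

lemma kborel_mult [measurable]:
  assumes "f \<in> measurable M kborel" "g \<in> measurable M kborel"
  shows "(\<lambda>x. f x * g x) \<in> measurable M kborel"
proof -
  have "case_prod (*) \<in> measurable (kborel \<Otimes>\<^sub>M kborel) kborel"
  proof (rule measurable_into_kborel_pair)
    fix x y k
    obtain g1 where g1: "av x \<le> ppow g1"
      using ex_ppow_ge by blast
    obtain g where g: "g \<ge> g1" "av y \<le> ppow g"
      using ex_ppow_ge by blast
    have gx: "av x \<le> ppow g"
      using g1 g ppow_le_iff[of g1 g] by linarith
    \<comment> \<open>For x'y' - xy = (x' - x)y' + x(y' - y): the exponent k - g makes both terms at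
      most p^k, and the exponent g keeps |y'| at most p^g.\<close>
    define j where "j = min (k - g) g"
    have "ppow j \<le> ppow (k - g)"
      unfolding ppow_le_iff by (simp add: j_def)
    then have jg: "ppow j * ppow g \<le> ppow k"
      using mult_right_mono[of "ppow j" "ppow (k - g)" "ppow g"] unfolding ppow_add[symmetric]
      by simp
    have jg': "ppow j \<le> ppow g"
      unfolding ppow_le_iff by (simp add: j_def)
    have "av (x' * y' - x * y) \<le> ppow k" if x': "av (x' - x) \<le> ppow j" and y': "av (y' - y) \<le> ppow j" for x' y'
    proof -
      have "av (y' - y) \<le> ppow g"
        using y' jg' by (rule order_trans)
      then have "av y' \<le> ppow g"
        using av_add[of "y' - y" y] g by simp
      then have "av ((x' - x) * y') \<le> ppow k"
        unfolding av_mult using mult_mono[OF x', of "av y'" "ppow g"] jg by simp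
      moreover have "av (x * (y' - y)) \<le> ppow k"
        unfolding av_mult using mult_mono[OF y' gx] jg by (simp add: mult.commute)
      ultimately show ?thesis
        using av_add[of "(x' - x) * y'" "x * (y' - y)"] by (simp add: algebra_simps)
    qed
    then show "\<exists>j. \<forall>x' y'. av (x' - x) \<le> ppow j \<longrightarrow> av (y' - y) \<le> ppow j \<longrightarrow>
        av (x' * y' - x * y) \<le> ppow k"
      by blast
  qed
  from measurable_compose[OF measurable_Pair[OF assms] this] show ?thesis
    by simp
qed

lemma kborel_const: "(\<lambda>x. c) \<in> measurable M kborel"
  by (rule measurable_const) simp

lemma kborel_sum:
  assumes "finite I" "\<And>i. i \<in> I \<Longrightarrow> f i \<in> measurable M kborel"
  shows "(\<lambda>x. \<Sum>i\<in>I. f i x) \<in> measurable M kborel"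
  using assms by (induction I) (auto intro: kborel_const kborel_add)

text \<open>A cylinder over one coordinate contains, with each of its points, the ball of radius p^k
  about it; it is thus a countable union of balls centred in \<open>vdense\<close>.\<close>

lemma coordinate_measurable: "(\<lambda>x :: 'k^'n. x $ i) \<in> measurable vborel kborel"
  unfolding kmeasurable_iff[symmetric] kmeasurable_def
proof (intro allI)
  fix c and k :: int
  have "{y \<in> space (vborel :: ('k^'n) measure). av (y $ i - c) \<le> ppow k}
      = (\<Union>d\<in>{d\<in>vdense. av (d $ i - c) \<le> ppow k}. pball P av d k)" (is "?L = ?R")
  proof (intro subset_antisym subsetI)
    fix x assume "x \<in> ?L"
    then have x: "av (x $ i - c) \<le> ppow k"
      by simp
    obtain d where d: "d \<in> vdense" "x \<in> pball P av d k"
      using vdense_approx by blast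
    then have "av (d $ i - x $ i) \<le> ppow k"
      using av_diff_commute[of "d $ i" "x $ i"] by (auto simp: mem_pball vnorm_le_iff)
    then have "av (d $ i - c) \<le> ppow k"
      using x av_add[of "d $ i - x $ i" "x $ i - c"] by simp
    then show "x \<in> ?R"
      using d by auto
  next
    fix x assume "x \<in> ?R"
    then obtain d where d: "av (d $ i - c) \<le> ppow k" "x \<in> pball P av d k"
      by auto
    then have "av (x $ i - d $ i) \<le> ppow k"
      by (auto simp: mem_pball vnorm_le_iff)
    then show "x \<in> ?L"
      using d av_add[of "x $ i - d $ i" "d $ i - c"] by simp
  qed
  also have "\<dots> \<in> sets vborel"
    by (intro sets.countable_UN' countable_subset[OF _ countable_vdense]) auto
  finally show "{y \<in> space (vborel :: ('k^'n) measure). av (y $ i - c) \<le> ppow k} \<in> sets vborel" .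
qed

text \<open>A ball for the maximum norm is a finite intersection of coordinate conditions.\<close>

lemma measurable_into_vborel:
  fixes f :: "'a \<Rightarrow> 'k^'n"
  assumes "\<And>i. (\<lambda>x. f x $ i) \<in> measurable M kborel"
  shows "f \<in> measurable M vborel"
  unfolding vborel_def
proof (rule measurable_measure_of)
  fix A assume "A \<in> range (\<lambda>(c :: 'k^'n, k). pball P av c k)"
  then obtain c :: "'k^'n" and k where A: "A = pball P av c k"
    by auto
  have eq: "f -` A \<inter> space M = (\<Inter>i. {x \<in> space M. av (f x $ i - c $ i) \<le> ppow k})"
    by (simp add: set_eq_iff A mem_pball vnorm_le_iff conj_commute)
  have "{x \<in> space M. av (f x $ i - c $ i) \<le> ppow k} \<in> sets M" for i
  proof -
    have "kmeasurable P av M (\<lambda>x. f x $ i)"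
      using assms by (simp only: kmeasurable_iff)
    then show ?thesis
      unfolding kmeasurable_def by (elim allE)
  qed
  then show "f -` A \<inter> space M \<in> sets M"
    unfolding eq by (rule sets.finite_INT[OF finite UNIV_not_empty])
qed auto

lemma av_measurable: "av \<in> borel_measurable kborel"
proof (rule borel_measurableI_less)
  fix a :: real
  have "{x \<in> space kborel. av x < a} = (\<Union>k\<in>{k. ppow k < a}. {x. av (x - 0) \<le> ppow k})" (is "?L = ?R")
  proof (intro subset_antisym subsetI)
    fix x assume x: "x \<in> ?L"
    show "x \<in> ?R"
    proof (cases "x = 0")
      case True
      then show ?thesis
        using x ex_ppow_less[of a] by (auto intro: less_imp_le[OF ppow_pos])
    next
      case False
      then show ?thesis
        using x av_value[of x] by force
    qed
  qed auto
  also have "\<dots> \<in> sets kborel"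
    by (intro sets.countable_UN'' ball_in_kborel) auto
  finally show "{x \<in> space kborel. av x < a} \<in> sets kborel" .
qed

lemma vnorm_measurable:
  "vnorm av \<in> borel_measurable (vborel :: ('k^'n) measure)"
proof -
  have "(\<lambda>x :: 'k^'n. av (x $ i)) \<in> borel_measurable vborel" for i
    by (rule measurable_compose[OF coordinate_measurable av_measurable])
  then show ?thesis
    unfolding vnorm_def by (intro borel_measurable_Max) auto
qed

lemma matrix_vector_measurable:
  fixes A :: "'a \<Rightarrow> 'k^'n^'n"
  assumes "\<And>i j. (\<lambda>x. A x $ i $ j) \<in> measurable M kborel" "g \<in> measurable M vborel"
  shows "(\<lambda>x. A x *v g x) \<in> measurable M vborel"
  unfolding matrix_vector_mult_def
  by (intro measurable_into_vborel)
    (auto intro!: kborel_sum kborel_mult assms measurable_compose[OF assms(2) coordinate_measurable])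

lemma mnorm_measurable:
  fixes A :: "'a \<Rightarrow> 'k^'n^'n"
  assumes "\<And>i j. (\<lambda>x. A x $ i $ j) \<in> measurable M kborel"
  shows "(\<lambda>x. mnorm av (A x)) \<in> borel_measurable M"
proof -
  have "(\<lambda>x. av (A x $ i $ j)) \<in> borel_measurable M" for i j
    by (rule measurable_compose[OF assms av_measurable])
  then show ?thesis
    unfolding mnorm_def by (intro borel_measurable_Max) (auto simp: case_prod_beta)
qed

lemma translation_measurable: "(\<lambda>x. a + x) \<in> measurable vborel (vborel :: ('k^'n) measure)"
proof (rule measurable_into_vborel)
  fix i
  show "(\<lambda>x. (a + x) $ i) \<in> measurable vborel kborel"
    using kborel_add[OF kborel_const coordinate_measurable] by simp
qed

lemma pball_translate: "pball P av (c :: 'k^'n) k = (\<lambda>x. c + x) ` pball P av 0 k"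
  by (auto simp: mem_pball intro!: image_eqI[of _ _ "_ - c"])

section \<open>Scaling of invariant measures on balls\<close>

definition residues :: "('k^'n) set" where
  "residues = {x. \<forall>i. x $ i \<in> of_nat ` {..<P}}"

lemma residues_image: "residues = vec_lambda ` PiE (UNIV :: 'n::finite set) (\<lambda>_. of_nat ` {..<P})"
proof (intro subset_antisym subsetI)
  fix x :: "'k^'n" assume "x \<in> residues"
  then show "x \<in> vec_lambda ` PiE UNIV (\<lambda>_. of_nat ` {..<P})"
    by (intro image_eqI[of _ _ "vec_nth x"]) (auto simp: residues_def PiE_def)
next
  fix x :: "'k^'n" assume "x \<in> vec_lambda ` PiE UNIV (\<lambda>_. of_nat ` {..<P})"
  then obtain f where "f \<in> PiE UNIV (\<lambda>_. of_nat ` {..<P})" "x = vec_lambda f"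
    by blast
  then show "x \<in> residues"
    using PiE_mem[of f UNIV "\<lambda>_. of_nat ` {..<P}"] by (simp add: residues_def)
qed

lemma finite_residues: "finite (residues :: ('k^'n) set)"
  unfolding residues_image by (intro finite_imageI finite_PiE) auto

lemma card_residues: "card (residues :: ('k^'n) set) = P ^ CARD('n)"
proof -
  have "inj_on (of_nat :: nat \<Rightarrow> 'k) {..<P}"
  proof (rule inj_onI)
    fix i j assume "i \<in> {..<P}" "j \<in> {..<P}" "(of_nat i :: 'k) = of_nat j"
    then show "i = j"
      using av_of_nat_diff[of i j] by fastforce
  qed
  then have "card ((of_nat :: nat \<Rightarrow> 'k) ` {..<P}) = P"
    by (simp add: card_image)
  moreover have "inj_on (vec_lambda :: ('n \<Rightarrow> 'k) \<Rightarrow> 'k^'n) S" for S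
    by (simp add: inj_on_def vec_lambda_inject)
  ultimately show ?thesis
    by (simp add: residues_image card_image card_PiE)
qed

text \<open>Reads off the leading digit of every coordinate: \<open>residues\<close> represents the
  integral vectors modulo p, so \<open>unif k *s d\<close> runs through the centres at the next
  smaller radius.\<close>

lemma pball_decompose:
  "pball P av (0 :: 'k^'n) k = (\<Union>d\<in>residues. pball P av (unif k *s d) (k - 1))"
proof (intro subset_antisym subsetI)
  fix x :: "'k^'n" assume "x \<in> pball P av 0 k"
  then have x: "av (x $ i) \<le> ppow k" for i
    by (simp add: mem_pball vnorm_le_iff)
  have "\<exists>j<P. av (x $ i - unif k * of_nat j) \<le> ppow (k - 1)" for i
  proof -
    have "av (x $ i / unif k) \<le> 1"
      using x[of i] ppow_pos[of k] by (simp add: divide_inverse av_mult av_inverse av_unif)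
        (simp add: divide_le_eq flip: divide_inverse)
    then obtain j where j: "j < P" "av (x $ i / unif k - of_nat j) < 1"
      using av_residue by blast
    have "x $ i - unif k * of_nat j = unif k * (x $ i / unif k - of_nat j)"
      by (simp add: right_diff_distrib)
    then have "av (x $ i - unif k * of_nat j) < ppow k"
      using j mult_strict_left_mono[OF j(2) ppow_pos[of k]] by (simp add: av_mult av_unif)
    then show ?thesis
      using j av_less_ppow_iff by blast
  qed
  then obtain j where j: "\<And>i. j i < P \<and> av (x $ i - unif k * of_nat (j i)) \<le> ppow (k - 1)"
    by metis
  show "x \<in> (\<Union>d\<in>residues. pball P av (unif k *s d) (k - 1))"
    using j by (intro UN_I[of "\<chi> i. of_nat (j i)"])
      (auto simp: residues_def mem_pball vnorm_le_iff simp del: of_int_diff)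
next
  fix x :: "'k^'n" assume "x \<in> (\<Union>d\<in>residues. pball P av (unif k *s d) (k - 1))"
  then obtain d where d: "d \<in> residues" "x \<in> pball P av (unif k *s d) (k - 1)"
    by blast
  have "av ((unif k *s d) $ i) \<le> ppow k" for i
  proof -
    have "d $ i \<in> of_nat ` {..<P}"
      using d(1) by (simp add: residues_def)
    then have "av (d $ i) \<le> 1"
      using av_of_nat_le_1 by auto
    then show ?thesis
      using mult_left_mono[of "av (d $ i)" 1 "ppow k"] by (simp add: av_mult av_unif)
  qed
  then have "vnorm av (unif k *s d) \<le> ppow k"
    unfolding vnorm_le_iff by blast
  moreover have "vnorm av (x - unif k *s d) \<le> ppow k"
    using d ppow_le_iff[of "k - 1" k] by (auto simp: mem_pball simp del: of_int_diff ppow_le_iff)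
  ultimately show "x \<in> pball P av 0 k"
    using vnorm_triangle[of x "unif k *s d" "ppow k" 0] by (simp add: mem_pball)
qed

lemma pball_decompose_disjoint:
  "disjoint_family_on (\<lambda>d. pball P av (unif k *s d :: 'k^'n) (k - 1)) residues"
  unfolding disjoint_family_on_def
proof (intro ballI impI, rule ccontr)
  fix d e :: "'k^'n" assume d: "d \<in> residues" "e \<in> residues" "d \<noteq> e"
    and "pball P av (unif k *s d) (k - 1) \<inter> pball P av (unif k *s e) (k - 1) \<noteq> {}"
  then obtain x where "x \<in> pball P av (unif k *s d) (k - 1)" "x \<in> pball P av (unif k *s e) (k - 1)"
    by blast
  then have le: "vnorm av (unif k *s d - unif k *s e) \<le> ppow (k - 1)"
    using vnorm_triangle vnorm_diff_commute[of x "unif k *s d"] unfolding mem_pball by metis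
  obtain i where i: "d $ i \<noteq> e $ i"
    using d by (auto simp: vec_eq_iff)
  moreover obtain a b where "d $ i = of_nat a" "a < P" "e $ i = of_nat b" "b < P"
    using d by (auto simp: residues_def image_iff Ball_def) (metis lessThan_iff)
  ultimately have "av (d $ i - e $ i) = 1"
    using av_of_nat_diff[of a b] by auto
  moreover have "(unif k *s d - unif k *s e) $ i = unif k * (d $ i - e $ i)"
    by (simp add: right_diff_distrib)
  ultimately have "av ((unif k *s d - unif k *s e) $ i) = ppow k"
    by (simp add: av_mult av_unif del: vector_minus_component)
  then have "ppow k \<le> ppow (k - 1)"
    using le unfolding vnorm_le_iff by metis
  then show False
    unfolding ppow_le_iff by simp
qed

text \<open>The smaller balls are disjoint translates of one another, one for each of the P^n
  residue vectors.\<close>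

lemma emeasure_pball_step:
  fixes M :: "('k^'n) measure"
  assumes M: "sets M = sets vborel" and inv: "translation_invariant M"
  shows "emeasure M (pball P av 0 k) = of_nat (P ^ CARD('n)) * emeasure M (pball P av 0 (k - 1))"
proof -
  have sets: "pball P av c j \<in> sets M" for c j
    using M by simp
  have "emeasure M (pball P av 0 k) = (\<Sum>d\<in>residues. emeasure M (pball P av (unif k *s d) (k - 1)))"
    unfolding pball_decompose[of k]
    by (rule sum_emeasure[symmetric]) (auto simp: sets finite_residues pball_decompose_disjoint simp del: of_int_diff)
  also have "\<dots> = (\<Sum>d\<in>(residues :: ('k^'n) set). emeasure M (pball P av 0 (k - 1)))"
    using inv sets unfolding translation_invariant_def pball_translate[of "unif k *s _"]
    by (intro sum.cong refl) blast
  finally show ?thesis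
    by (simp add: card_residues)
qed

lemma ppow_power_step: "ennreal (ppow k ^ n) = of_nat (P ^ n) * ennreal (ppow (k - 1) ^ n)"
proof -
  have "ppow k = real P * ppow (k - 1)"
    using P_gt_1 by (simp add: powr_diff)
  then have "ppow k ^ n = real (P ^ n) * ppow (k - 1) ^ n"
    by (simp only: power_mult_distrib of_nat_power)
  then show ?thesis
    by (simp only: ennreal_mult' of_nat_0_le_iff ennreal_of_nat_eq_real_of_nat)
qed

lemma emeasure_pball:
  fixes M :: "('k^'n) measure"
  assumes M: "sets M = sets vborel" and inv: "translation_invariant M"
  shows "emeasure M (pball P av c k) = ennreal (ppow k ^ CARD('n)) * emeasure M (pball P av 0 0)"
proof -
  have "emeasure M (pball P av 0 k) = ennreal (ppow k ^ CARD('n)) * emeasure M (pball P av 0 0)" for k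
  proof (induction k rule: int_induct[where k = 0])
    case base
    then show ?case
      using P_gt_1 by simp
  next
    case (step1 i)
    then show ?case
      using emeasure_pball_step[OF assms, of "i + 1"] ppow_power_step[of "i + 1" "CARD('n)"]
      by (simp only: mult.assoc add_diff_cancel_right')
  next
    \<comment> \<open>Going down, the factor P^n is cancelled in \<open>ennreal\<close>, which is
      legitimate because it is neither 0 nor infinite.\<close>
    case (step2 i)
    have "of_nat (P ^ CARD('n)) * emeasure M (pball P av 0 (i - 1))
        = of_nat (P ^ CARD('n)) * (ennreal (ppow (i - 1) ^ CARD('n)) * emeasure M (pball P av 0 0))"
      using step2 emeasure_pball_step[OF assms, of i] ppow_power_step[of i "CARD('n)"]
      by (simp only: mult.assoc)
    moreover have "of_nat (P ^ CARD('n)) \<noteq> (top :: ennreal)" "of_nat (P ^ CARD('n)) \<noteq> (0 :: ennreal)"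
      using P_gt_1 by (simp_all only: ennreal_of_nat_neq_top of_nat_eq_0_iff not_False_eq_True) simp
    ultimately show ?case
      unfolding ennreal_mult_cancel_left by blast
  qed
  moreover have "emeasure M ((\<lambda>x. c + x) ` pball P av 0 k) = emeasure M (pball P av 0 k)"
    using inv M pball_in_vborel[of 0 k] by (simp add: translation_invariant_def)
  ultimately show ?thesis
    unfolding pball_translate[of c k] by (metis (no_types))
qed

end

section \<open>Uniqueness of Haar measure and linear substitutions\<close>

locale padic_haar_space = padic P av for P and av :: "'k::field \<Rightarrow> real" +
  fixes \<mu> :: "('k^'n) measure"
  assumes haar: "padic_haar P av \<mu>"
begin

lemma space_haar [simp]: "space \<mu> = UNIV"
  and sets_haar [measurable_cong]: "sets \<mu> = sets vborel"
  and haar_invariant: "translation_invariant \<mu>"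
  and emeasure_unit_ball: "emeasure \<mu> (pball P av 0 0) = 1"
  using haar unfolding padic_haar_def sets_vborel translation_invariant_def by simp_all

lemma emeasure_haar_pball: "emeasure \<mu> (pball P av c k) = ennreal (ppow k ^ CARD('n))"
  using emeasure_pball[OF sets_haar haar_invariant, of c k] by (simp add: emeasure_unit_ball)

lemma pball_cover: "(\<Union>i. pball P av (0 :: 'k^'n) (int i)) = UNIV"
proof (intro equalityI subsetI UNIV_I)
  fix x :: "'k^'n"
  obtain k where "k \<ge> 0" "vnorm av x \<le> ppow k"
    using ex_ppow_ge by blast
  then show "x \<in> (\<Union>i. pball P av 0 (int i))"
    by (intro UN_I[of "nat k"]) (auto simp: mem_pball)
qed

sublocale sigma_finite_measure \<mu>
proof
  show "\<exists>A. countable A \<and> A \<subseteq> sets \<mu> \<and> \<Union> A = space \<mu> \<and> (\<forall>a\<in>A. emeasure \<mu> a \<noteq> \<infinity>)"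
    using pball_cover
    by (intro exI[of _ "range (\<lambda>i. pball P av 0 (int i))"]) (auto simp: sets_haar emeasure_haar_pball)
qed

text \<open>Invariance alone determines a measure on balls up to its value on the unit ball. The
  balls form an intersection-stable generator with an exhausting sequence of finite measure, so
  agreement on them extends to all Borel sets.\<close>

lemma haar_unique:
  fixes M :: "('k^'n) measure"
  assumes M: "sets M = sets vborel" and inv: "translation_invariant M"
    and fin: "emeasure M (pball P av 0 0) < \<infinity>"
  shows "M = scale_measure (emeasure M (pball P av 0 0)) \<mu>" (is "_ = ?N")
proof (rule measure_eqI_generator_eq[OF Int_stable_pballs, where \<Omega> = UNIV and A = "\<lambda>i. pball P av 0 (int i)"])
  have eq: "sigma_sets UNIV (insert {} (range (\<lambda>(c :: 'k^'n, k). pball P av c k))) = sets vborel"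
    unfolding sets_vborel
    by (intro sigma_sets_eqI) (auto intro: sigma_sets.Empty sigma_sets.Basic)
  show "sets M = sigma_sets UNIV (insert {} (range (\<lambda>(c :: 'k^'n, k). pball P av c k)))"
    "sets ?N = sigma_sets UNIV (insert {} (range (\<lambda>(c :: 'k^'n, k). pball P av c k)))"
    by (simp_all only: eq M sets_scale_measure sets_haar)
  have ball: "emeasure M (pball P av c k) = emeasure ?N (pball P av c k)" for c k
    by (subst emeasure_pball[OF M inv]) (simp only: emeasure_scale_measure emeasure_haar_pball mult.commute)
  show "emeasure M X = emeasure ?N X" if "X \<in> insert {} (range (\<lambda>(c, k). pball P av c k))" for X
    using that
  proof (elim insertE rangeE)
    assume "X = {}"
    then show ?thesis
      by simp
  next
    fix p assume X: "X = (case p of (c, k) \<Rightarrow> pball P av c k)"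
    show ?thesis
      unfolding X case_prod_beta by (rule ball)
  qed
  show "emeasure M (pball P av 0 (int i)) \<noteq> \<infinity>" for i
    using fin by (subst emeasure_pball[OF M inv]) (auto simp: ennreal_mult_eq_top_iff)
qed (use pball_cover in auto)

text \<open>The exact factor would be 1/|det A|. The bound by the norm of the inverse loses, under
  (DK1), at most P^(\<nu> n).\<close>

lemma nn_integral_matrix_le:
  fixes A :: "'k^'n^'n"
  assumes A: "invertible A" and f: "f \<in> borel_measurable \<mu>"
  shows "(\<integral>\<^sup>+ x. f (A *v x) \<partial>\<mu>) \<le> ennreal (mnorm av (matrix_inv A) ^ CARD('n)) * (\<integral>\<^sup>+ x. f x \<partial>\<mu>)"
proof -
  let ?T = "\<lambda>x. A *v x"
  have T: "?T \<in> measurable \<mu> \<mu>"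
    using matrix_vector_measurable[of "\<lambda>_. A" vborel "\<lambda>x. x"] kborel_const
    by (simp add: measurable_cong_sets[OF sets_haar sets_haar])
  define M where "M = distr \<mu> \<mu> ?T"
  have M: "sets M = sets vborel"
    by (simp add: M_def sets_haar)
  have "translation_invariant M"
    unfolding translation_invariant_def
  proof (intro ballI allI)
    fix S a assume S: "S \<in> sets M"
    then have S': "S \<in> sets \<mu>"
      by (simp add: M_def)
    have aS: "(\<lambda>x. a + x) ` S \<in> sets \<mu>"
    proof -
      have "(\<lambda>x. a + x) ` S = (\<lambda>x. - a + x) -` S \<inter> space vborel"
        by (auto intro!: image_eqI[of _ _ "_ - a"])
      then show ?thesis
        using measurable_sets[OF translation_measurable, of S "- a"] S' by (simp add: sets_haar)
    qed
    \<comment> \<open>Linearity turns translation by a after the map into translation by the inverse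
      image of a before it, so the invariance of \<mu> passes to the pushforward.\<close>
    have "?T -` ((\<lambda>x. a + x) ` S) = (\<lambda>x. matrix_inv A *v a + x) ` (?T -` S)" (is "?L = ?R")
    proof (intro subset_antisym subsetI)
      fix x assume "x \<in> ?L"
      then obtain s where "s \<in> S" "A *v x = a + s"
        by auto
      then have "A *v (x - matrix_inv A *v a) \<in> S"
        by (simp add: matrix_vector_mult_diff_distrib matrix_inv_vec[OF A])
      then show "x \<in> ?R"
        by (intro image_eqI[of _ _ "x - matrix_inv A *v a"]) auto
    next
      fix x assume "x \<in> ?R"
      then show "x \<in> ?L"
        by (auto simp: matrix_vector_right_distrib matrix_inv_vec[OF A])
    qed
    then show "emeasure M ((\<lambda>x. a + x) ` S) = emeasure M S"
      using haar_invariant measurable_sets[OF T S'] aS S' T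
      by (simp add: M_def emeasure_distr translation_invariant_def)
  qed
  moreover have c: "emeasure M (pball P av 0 0) \<le> ennreal (mnorm av (matrix_inv A) ^ CARD('n))"
  proof -
    have "mnorm av (matrix_inv A) \<noteq> 0"
      using mnorm_matrix_inv[OF A] by auto
    then obtain k where k: "mnorm av (matrix_inv A) = ppow k"
      using mnorm_value by blast
    have "x \<in> pball P av 0 k" if "A *v x \<in> pball P av 0 0" for x
    proof -
      have "vnorm av x \<le> ppow k * vnorm av (A *v x)"
        using vnorm_mult_vec[of "matrix_inv A" "A *v x"] by (simp add: matrix_inv_vec[OF A] k)
      also have "\<dots> \<le> ppow k * 1"
        using that P_gt_1 by (intro mult_left_mono) (auto simp: mem_pball)
      finally show ?thesis
        by (simp add: mem_pball)
    qed
    then have "emeasure M (pball P av 0 0) \<le> emeasure \<mu> (pball P av 0 k)"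
      using T by (auto simp: M_def emeasure_distr sets_haar intro!: emeasure_mono)
    then show ?thesis
      by (simp add: emeasure_haar_pball k)
  qed
  ultimately have eq: "M = scale_measure (emeasure M (pball P av 0 0)) \<mu>"
    using M by (intro haar_unique) (auto intro: le_less_trans)
  have "(\<integral>\<^sup>+ x. f (A *v x) \<partial>\<mu>) = (\<integral>\<^sup>+ x. f x \<partial>M)"
    unfolding M_def by (rule nn_integral_distr[symmetric, OF T]) (use f in simp)
  also have "\<dots> = emeasure M (pball P av 0 0) * (\<integral>\<^sup>+ x. f x \<partial>\<mu>)"
    by (subst eq) (rule nn_integral_scale_measure[OF f])
  also have "\<dots> \<le> ennreal (mnorm av (matrix_inv A) ^ CARD('n)) * (\<integral>\<^sup>+ x. f x \<partial>\<mu>)"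
    using c by (rule mult_right_mono) simp
  finally show ?thesis .
qed

end

section \<open>Integral inequalities\<close>

text \<open>Concavity of the logarithm; a vanishing factor is handled separately.\<close>

lemma weighted_arith_geom_mean:
  fixes x p :: "'a \<Rightarrow> real"
  assumes S: "finite S" and p: "\<And>i. i \<in> S \<Longrightarrow> p i > 0" "(\<Sum>i\<in>S. p i) = 1"
    and x: "\<And>i. i \<in> S \<Longrightarrow> x i \<ge> 0"
  shows "(\<Prod>i\<in>S. x i powr p i) \<le> (\<Sum>i\<in>S. p i * x i)"
proof (cases "\<exists>i\<in>S. x i = 0")
  case True
  then obtain i where "i \<in> S" "x i = 0"
    by blast
  then have "(\<Prod>i\<in>S. x i powr p i) = 0"
    using S by (intro prod_zero) auto
  moreover have "(\<Sum>i\<in>S. p i * x i) \<ge> 0"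
    by (intro sum_nonneg mult_nonneg_nonneg x) (auto intro: less_imp_le p)
  ultimately show ?thesis
    by simp
next
  case False
  then have pos: "x i > 0" if "i \<in> S" for i
    using x[OF that] that by force
  have ne: "S \<noteq> {}"
    using p by auto
  have "(\<Sum>i\<in>S. p i * ln (x i)) \<le> ln (\<Sum>i\<in>S. p i *\<^sub>R x i)"
  proof (intro concave_on_sum)
    show "concave_on {0<..} ln"
      by (simp add: ln_concave)
  qed (use S ne p pos in \<open>auto intro: less_imp_le\<close>)
  moreover have "(\<Sum>i\<in>S. p i *\<^sub>R x i) > 0"
    using S ne p pos by (intro sum_pos) auto
  ultimately have "exp (\<Sum>i\<in>S. p i * ln (x i)) \<le> (\<Sum>i\<in>S. p i *\<^sub>R x i)"
    using ln_ge_iff by blast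
  moreover have "(\<Prod>i\<in>S. x i powr p i) = exp (\<Sum>i\<in>S. p i * ln (x i))"
    unfolding exp_sum[OF S] using pos by (intro prod.cong) (simp_all add: powr_def order_less_imp_not_eq2)
  ultimately show ?thesis
    by simp
qed

text \<open>As a function of t^q the left side is concave and the right side is its tangent at t =
  s. It is Young's inequality for the weights 1/q and 1 - 1/q.\<close>

lemma le_powr_tangent:
  fixes s t :: real
  assumes "q \<ge> 1" "s > 0" "t \<ge> 0"
  shows "t \<le> s powr (1 - q) / q * t powr q + s * (1 - 1 / q)"
proof (cases "t = 0")
  case True
  then show ?thesis
    using assms by (auto simp: divide_simps)
next
  case False
  then have t: "t > 0"
    using assms by simp
  have "(s powr (1 - q) * t powr q) powr (1 / q) * s powr (1 - 1 / q)
      \<le> 1 / q * (s powr (1 - q) * t powr q) + (1 - 1 / q) * s"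
    using assms t by (intro Youngs_inequality_0) auto
  moreover have "(s powr (1 - q) * t powr q) powr (1 / q) * s powr (1 - 1 / q)
      = s powr ((1 - q) * (1 / q) + (1 - 1 / q)) * t"
    using assms t by (simp add: powr_mult powr_powr flip: powr_add)
  moreover have "(1 - q) * (1 / q) + (1 - 1 / q) = 0"
    using assms by (simp add: field_simps)
  ultimately show ?thesis
    using assms by (simp add: mult.commute)
qed

text \<open>Jensen's inequality for \<open>t \<mapsto> t\<^sup>q\<close> and the weight \<open>k\<close> of total mass \<open>T\<close>: integrate the tangent
  inequality at the point \<open>s = (R / T)\<^bsup>1 / q\<^esup>\<close>.\<close>

lemma nn_integral_weighted_le:
  fixes k h :: "'a \<Rightarrow> real"
  assumes [measurable]: "k \<in> borel_measurable M" "h \<in> borel_measurable M"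
    and k: "\<And>x. k x \<ge> 0" and h: "\<And>x. h x \<ge> 0" and q: "q \<ge> 1"
    and T: "(\<integral>\<^sup>+ x. ennreal (k x) \<partial>M) = ennreal T" "T \<ge> 0"
    and R: "(\<integral>\<^sup>+ x. ennreal (k x * h x powr q) \<partial>M) = ennreal R" "R \<ge> 0"
  shows "(\<integral>\<^sup>+ x. ennreal (k x * h x) \<partial>M) \<le> ennreal ((T powr (q - 1) * R) powr (1 / q))"
proof (cases "T = 0 \<or> R = 0")
  case True
  \<comment> \<open>In these cases the tangent point would not be a positive number, but the
    integrand vanishes almost everywhere.\<close>
  have "AE x in M. ennreal (k x * h x) = 0"
  proof (cases "T = 0")
    case True
    then have "AE x in M. ennreal (k x) = 0"
      using T by (simp add: nn_integral_0_iff_AE)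
    then show ?thesis
    proof eventually_elim
      case (elim x)
      then have "k x = 0"
        using k[of x] by (simp add: ennreal_eq_0_iff)
      then show ?case
        by simp
    qed
  next
    case False
    then have "AE x in M. ennreal (k x * h x powr q) = 0"
      using True R by (simp add: nn_integral_0_iff_AE)
    then show ?thesis
    proof eventually_elim
      case (elim x)
      then have "k x * h x powr q \<le> 0"
        by (simp add: ennreal_eq_0_iff)
      then have "k x = 0 \<or> h x = 0"
        using k[of x] h[of x] by (metis mult_nonneg_nonneg mult_eq_0_iff order_antisym powr_eq_0_iff powr_ge_zero)
      then show ?case
        by auto
    qed
  qed
  then have "(\<integral>\<^sup>+ x. ennreal (k x * h x) \<partial>M) = 0"
    by (subst nn_integral_0_iff_AE) auto
  then show ?thesis
    by simp
next
  case False
  then have pos: "T > 0" "R > 0"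
    using T R by auto
  define s where "s = (R / T) powr (1 / q)"
  have s: "s > 0"
    using pos by (simp add: s_def)
  define a b where "a = s powr (1 - q) / q" and "b = s * (1 - 1 / q)"
  have ab: "a \<ge> 0" "b \<ge> 0"
    using q s by (auto simp: a_def b_def)
  have "(\<integral>\<^sup>+ x. ennreal (k x * h x) \<partial>M)
      \<le> (\<integral>\<^sup>+ x. ennreal a * ennreal (k x * h x powr q) + ennreal b * ennreal (k x) \<partial>M)"
  proof (intro nn_integral_mono)
    fix x
    have "k x * h x \<le> k x * (a * h x powr q + b)"
      unfolding a_def b_def using k h by (intro mult_left_mono le_powr_tangent q s)
    also have "\<dots> = a * (k x * h x powr q) + b * k x"
      by (simp add: algebra_simps)
    finally have "ennreal (k x * h x) \<le> ennreal (a * (k x * h x powr q) + b * k x)"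
      by (rule ennreal_leI)
    then show "ennreal (k x * h x) \<le> ennreal a * ennreal (k x * h x powr q) + ennreal b * ennreal (k x)"
      using ab k h by (simp add: ennreal_plus ennreal_mult)
  qed
  also have "\<dots> = ennreal a * ennreal R + ennreal b * ennreal T"
    using T R by (simp add: nn_integral_add nn_integral_cmult)
  also have "\<dots> = ennreal (a * R + b * T)"
    using ab T R by (simp add: ennreal_plus ennreal_mult)
  \<comment> \<open>By the choice of s, s^q T = R, so the two terms are the fractions 1/q and 1 -
    1/q of s T.\<close>
  also have "a * R + b * T = s * T"
  proof -
    have "s powr q = R / T"
      using q pos by (simp add: s_def powr_powr)
    then have "s powr (1 - q) * R = s * T"
      using s pos by (simp add: powr_diff)
    then have "a * R = s * T / q"
      by (simp add: a_def)
    then show ?thesis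
      using q by (simp add: b_def field_simps)
  qed
  also have "s * T = (T powr (q - 1) * R) powr (1 / q)"
  proof -
    have "(T powr (q - 1) * R) powr (1 / q) = T powr ((q - 1) * (1 / q)) * R powr (1 / q)"
      using pos by (simp add: powr_mult powr_powr)
    also have "(q - 1) * (1 / q) = 1 - 1 / q"
      using q by (simp add: field_simps)
    finally show ?thesis
      using pos by (simp add: s_def powr_divide powr_diff)
  qed
  finally show ?thesis .
qed

text \<open>The exponent may have either sign. For each sign one of the inequalities is monotonicity
  and the other costs the factor D^|a|.\<close>

lemma powr_comparable:
  fixes t u D :: real
  assumes "0 < u" "u \<le> t" "t \<le> D * u"
  shows "t powr a \<le> D powr \<bar>a\<bar> * u powr a" and "u powr a \<le> D powr \<bar>a\<bar> * t powr a"
proof -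
  have "1 * u \<le> D * u"
    using assms by linarith
  then have D: "D \<ge> 1"
    using assms by (simp only: mult_le_cancel_right)
  show "t powr a \<le> D powr \<bar>a\<bar> * u powr a"
  proof (cases "a \<ge> 0")
    case True
    then show ?thesis
      using powr_mono2[of a t "D * u"] assms by (simp add: powr_mult)
  next
    case False
    then have "t powr a \<le> u powr a"
      using assms by (intro powr_mono2') auto
    also have "\<dots> \<le> D powr \<bar>a\<bar> * u powr a"
      using D ge_one_powr_ge_zero[of D "\<bar>a\<bar>"] mult_right_mono[of 1 "D powr \<bar>a\<bar>" "u powr a"] by simp
    finally show ?thesis .
  qed
  show "u powr a \<le> D powr \<bar>a\<bar> * t powr a"
  proof (cases "a \<ge> 0")
    case True
    then have "u powr a \<le> t powr a"
      using assms by (intro powr_mono2) auto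
    also have "\<dots> \<le> D powr \<bar>a\<bar> * t powr a"
      using D ge_one_powr_ge_zero[of D "\<bar>a\<bar>"] mult_right_mono[of 1 "D powr \<bar>a\<bar>" "t powr a"] by simp
    finally show ?thesis .
  next
    case False
    have "u powr a = D powr \<bar>a\<bar> * (D * u) powr a"
      using False assms D by (simp add: powr_mult powr_minus)
    also have "\<dots> \<le> D powr \<bar>a\<bar> * t powr a"
      using False assms by (intro mult_left_mono powr_mono2') auto
    finally show ?thesis .
  qed
qed

section \<open>Power weights on balls and under dilations\<close>

context padic_haar_space
begin

lemma ppow_power_dim: "ppow k ^ CARD('n) = ppow k powr real CARD('n)"
  by (rule powr_realpow[OF ppow_pos, symmetric])

lemma measurable_haar_cong: "measurable M \<mu> = measurable M vborel" "measurable \<mu> N = measurable vborel N"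
  by (intro measurable_cong_sets sets_haar refl)+

lemma vnorm_borel [measurable]: "vnorm av \<in> borel_measurable \<mu>"
  unfolding measurable_haar_cong by (rule vnorm_measurable)

lemma pball_haar [measurable]: "pball P av c k \<in> sets \<mu>"
  by (simp add: sets_haar)

text \<open>The integral of |x|^\<beta> over the unit ball in dimension d: the sphere of radius p^-i
  has measure p^(-id) (1 - p^-d), and summing over the spheres gives a geometric series.\<close>

definition ball_weight :: "real \<Rightarrow> real \<Rightarrow> real" where
  "ball_weight d \<beta> = (1 - real P powr - d) / (1 - real P powr - (\<beta> + d))"

lemma ball_weight_pos: "d > 0 \<Longrightarrow> \<beta> > - d \<Longrightarrow> ball_weight d \<beta> > 0"
  unfolding ball_weight_def using P_gt_1
  by (intro divide_pos_pos) (auto simp: powr_less_one)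

lemma emeasure_sphere:
  "emeasure \<mu> {x. vnorm av x = ppow k} = ennreal (ppow k powr real CARD('n) * (1 - real P powr - real CARD('n)))"
proof -
  have eq: "{x :: 'k^'n. vnorm av x = ppow k} = pball P av 0 k - pball P av 0 (k - 1)"
    unfolding set_eq_iff Diff_iff mem_pball vnorm_less_ppow_iff[symmetric] by auto
  have sub: "pball P av (0 :: 'k^'n) (k - 1) \<subseteq> pball P av 0 k"
    by (intro pball_mono) simp
  have "emeasure \<mu> {x. vnorm av x = ppow k} = ennreal (ppow k ^ CARD('n)) - ennreal (ppow (k - 1) ^ CARD('n))"
    unfolding eq emeasure_haar_pball[symmetric, of _ 0]
    by (intro emeasure_Diff sub pball_haar) (simp add: emeasure_haar_pball)
  also have "\<dots> = ennreal (ppow k ^ CARD('n) - ppow (k - 1) ^ CARD('n))"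
    by (rule ennreal_minus) (intro zero_le_power less_imp_le ppow_pos)
  also have "ppow k ^ CARD('n) - ppow (k - 1) ^ CARD('n) = ppow k powr real CARD('n) * (1 - real P powr - real CARD('n))"
    unfolding ppow_power_dim
    by (simp add: right_diff_distrib powr_powr flip: powr_add) (simp add: algebra_simps)
  finally show ?thesis .
qed

lemma nn_integral_vnorm_powr:
  assumes \<beta>: "\<beta> > - real CARD('n)"
  shows "(\<integral>\<^sup>+ x\<in>pball P av 0 k. ennreal (vnorm av x powr \<beta>) \<partial>\<mu>)
    = ennreal (ball_weight CARD('n) \<beta> * ppow k powr (\<beta> + real CARD('n)))"
proof -
  define S where "S i = {x :: 'k^'n. vnorm av x = ppow (k - int i)}" for i
  \<comment> \<open>Passing to the next smaller sphere multiplies weight times measure by r; the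
    hypothesis on \<beta> makes r < 1.\<close>
  define r where "r = real P powr - (\<beta> + real CARD('n))"
  have r: "0 < r" "r < 1"
    using P_gt_1 \<beta> by (auto simp: r_def powr_less_one)
  have S [measurable]: "S i \<in> sets \<mu>" for i
    using measurable_sets[OF vnorm_borel, of "{ppow (k - int i)}"]
    by (simp add: S_def vimage_def del: of_int_diff)
  have "ennreal (vnorm av x powr \<beta>) * indicator (pball P av 0 k) x
      = (\<Sum>i. ennreal (ppow (k - int i) powr \<beta>) * indicator (S i) x)" for x
  proof (cases "x \<in> pball P av 0 k \<and> x \<noteq> 0")
    case True
    then obtain j where j: "vnorm av x = ppow j"
      using vnorm_value by blast
    then have jk: "j \<le> k"
      using True by (simp add: mem_pball)
    define i0 where "i0 = nat (k - j)"
    have "j = k - int i \<longleftrightarrow> i = i0" for i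
      using jk by (auto simp: i0_def)
    then have Si: "x \<in> S i \<longleftrightarrow> i = i0" for i
      unfolding S_def mem_Collect_eq j ppow_eq_iff .
    have eq: "(\<lambda>i. ennreal (ppow (k - int i) powr \<beta>) * indicator (S i) x)
        = (\<lambda>i. if i = i0 then ennreal (vnorm av x powr \<beta>) else 0)"
    proof
      fix i
      show "ennreal (ppow (k - int i) powr \<beta>) * indicator (S i) x
          = (if i = i0 then ennreal (vnorm av x powr \<beta>) else 0)"
      proof (cases "i = i0")
        case True
        then have "x \<in> S i"
          using Si by simp
        then show ?thesis
          using True by (simp add: S_def del: of_int_diff)
      next
        case False
        then show ?thesis
          using Si by simp
      qed
    qed
    show ?thesis
      unfolding eq using True sums_unique[OF sums_single[of i0 "\<lambda>_. ennreal (vnorm av x powr \<beta>)"]] by simp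
  next
    case False
    have "x \<notin> S i" for i
    proof
      assume "x \<in> S i"
      then have i: "vnorm av x = ppow (k - int i)"
        by (simp add: S_def)
      moreover have "ppow (k - int i) \<le> ppow k"
        unfolding ppow_le_iff by simp
      ultimately have "x \<in> pball P av 0 k"
        by (simp add: mem_pball)
      moreover have "vnorm av x \<noteq> 0"
        unfolding i using ppow_pos less_irrefl by metis
      ultimately show False
        using False by auto
    qed
    then have "(\<lambda>i. ennreal (ppow (k - int i) powr \<beta>) * indicator (S i) x) = (\<lambda>i. 0)"
      by (simp add: indicator_def)
    \<comment> \<open>At the origin, which lies on none of the spheres, the integrand is 0 too:
      \<open>0 powr \<beta>\<close> is 0 by convention, also for negative \<beta>.\<close>
    moreover have "ennreal (vnorm av x powr \<beta>) * indicator (pball P av 0 k) x = 0"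
    proof (cases "x = 0")
      case True
      then have "vnorm av x = 0"
        by simp
      then show ?thesis
        by simp
    qed (use False in simp)
    ultimately show ?thesis
      by simp
  qed
  then have "(\<integral>\<^sup>+ x\<in>pball P av 0 k. ennreal (vnorm av x powr \<beta>) \<partial>\<mu>)
      = (\<Sum>i. \<integral>\<^sup>+ x. ennreal (ppow (k - int i) powr \<beta>) * indicator (S i) x \<partial>\<mu>)"
    by (simp add: nn_integral_suminf)
  also have "\<dots> = (\<Sum>i. ennreal ((1 - real P powr - real CARD('n)) * ppow k powr (\<beta> + real CARD('n)) * r ^ i))"
  proof (rule suminf_cong)
    fix i
    have "(\<integral>\<^sup>+ x. ennreal (ppow (k - int i) powr \<beta>) * indicator (S i) x \<partial>\<mu>)
        = ennreal (ppow (k - int i) powr \<beta> * (ppow (k - int i) powr real CARD('n) * (1 - real P powr - real CARD('n))))"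
      unfolding nn_integral_cmult_indicator[OF S] unfolding S_def emeasure_sphere
      by (rule ennreal_mult'[symmetric]) (rule powr_ge_zero)
    also have "ppow (k - int i) powr \<beta> * (ppow (k - int i) powr real CARD('n) * (1 - real P powr - real CARD('n)))
        = (1 - real P powr - real CARD('n)) * ppow (k - int i) powr (\<beta> + real CARD('n))"
      by (simp add: powr_add)
    also have "ppow (k - int i) powr (\<beta> + real CARD('n)) = ppow k powr (\<beta> + real CARD('n)) * r ^ i"
    proof -
      have "r ^ i = real P powr (- (\<beta> + real CARD('n)) * real i)"
        using P_gt_1 by (simp add: r_def powr_powr flip: powr_realpow)
      then show ?thesis
        by (simp add: powr_powr left_diff_distrib algebra_simps flip: powr_add)
    qed
    finally show "(\<integral>\<^sup>+ x. ennreal (ppow (k - int i) powr \<beta>) * indicator (S i) x \<partial>\<mu>)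
        = ennreal ((1 - real P powr - real CARD('n)) * ppow k powr (\<beta> + real CARD('n)) * r ^ i)"
      by (simp add: mult.assoc)
  qed
  also have "\<dots> = ennreal ((1 - real P powr - real CARD('n)) * ppow k powr (\<beta> + real CARD('n)) * (1 / (1 - r)))"
  proof (rule suminf_ennreal_eq)
    show "0 \<le> (1 - real P powr - real CARD('n)) * ppow k powr (\<beta> + real CARD('n)) * r ^ i" for i
      using r P_gt_1 powr_less_one[of "real P" "- real CARD('n)"] by (intro mult_nonneg_nonneg) auto
    show "(\<lambda>i. (1 - real P powr - real CARD('n)) * ppow k powr (\<beta> + real CARD('n)) * r ^ i) sums
        ((1 - real P powr - real CARD('n)) * ppow k powr (\<beta> + real CARD('n)) * (1 / (1 - r)))"
      using r by (intro sums_mult geometric_sums) simp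
  qed
  finally show ?thesis
    by (simp add: ball_weight_def r_def)
qed

lemma AE_nonzero: "AE x in \<mu>. x \<noteq> 0"
proof (rule AE_I)
  show "{x \<in> space \<mu>. \<not> x \<noteq> 0} \<subseteq> {0}"
    by auto
  have "{0} = {x \<in> space \<mu>. vnorm av x = 0}"
    by auto
  also have "\<dots> \<in> sets \<mu>"
    by measurable
  finally show "{0} \<in> sets \<mu>" .
  have "emeasure \<mu> {0} \<le> 0 + ennreal e" if "e > 0" for e
  proof -
    \<comment> \<open>For a radius below 1 the n-th power is at most the radius itself, so the same
      k serves in every dimension.\<close>
    have "\<exists>k. ppow k < min e 1"
      using that by (intro ex_ppow_less) simp
    then obtain k where k: "ppow k < min e 1"
      by blast
    have "emeasure \<mu> {0} \<le> emeasure \<mu> (pball P av 0 k)"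
      by (intro emeasure_mono) auto
    also have "\<dots> \<le> ennreal (ppow k ^ 1)"
      unfolding emeasure_haar_pball using k
      by (intro ennreal_leI power_decreasing) (auto simp: Suc_le_eq)
    also have "\<dots> \<le> ennreal e"
      using k by (intro ennreal_leI) simp
    finally show ?thesis
      by simp
  qed
  then show "emeasure \<mu> {0} = 0"
    using ennreal_le_epsilon[of 0 "emeasure \<mu> {0}"] by simp
qed

lemma AE_ex_nonzero:
  assumes "AE x in \<mu>. Q x"
  shows "\<exists>x. x \<noteq> 0 \<and> Q x"
proof (rule ccontr)
  assume "\<not> (\<exists>x. x \<noteq> 0 \<and> Q x)"
  then have "AE x in \<mu>. False"
    using eventually_conj[OF assms AE_nonzero] by (auto elim: eventually_mono)
  then have "emeasure \<mu> (space \<mu>) = 0"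
    by (simp only: eventually_False ae_filter_eq_bot_iff)
  moreover have "emeasure \<mu> (pball P av 0 0) \<le> emeasure \<mu> (space \<mu>)"
    by (rule emeasure_space)
  ultimately show False
    using emeasure_unit_ball by simp
qed

text \<open>By (DK1), |x| lies between p^-k |Ax| and P^\<nu> p^-k |Ax|. The weight thus costs
  P^(\<nu> |a|) p^(-ka), the substitution costs P^(\<nu> n) p^(-kn), and A maps B_g into
  B_(g+k).\<close>

lemma nn_integral_dilation_le:
  fixes A :: "'k^'n^'n" and f :: "'k^'n \<Rightarrow> real"
  assumes A: "invertible A" "mnorm av A = ppow k" "mnorm av A * mnorm av (matrix_inv A) \<le> real P ^ \<nu>"
    and f [measurable]: "f \<in> borel_measurable \<mu>"
  shows "(\<integral>\<^sup>+ x\<in>pball P av 0 g. ennreal (\<bar>f (A *v x)\<bar> powr q * vnorm av x powr a) \<partial>\<mu>)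
    \<le> ennreal (real P powr (\<nu> * (\<bar>a\<bar> + real CARD('n))) * ppow k powr - (a + real CARD('n)))
      * lqball P av \<mu> (\<lambda>x. vnorm av x powr a) q f (g + k)"
proof -
  define D where "D = real P ^ \<nu>"
  define b where "b = mnorm av (matrix_inv A)"
  have b: "b \<le> D * inverse (ppow k)" "b \<ge> 0"
    using A(3) ppow_pos[of k] unfolding A(2) D_def b_def
    by (simp_all add: field_simps)
  define G where "G z = ennreal (\<bar>f z\<bar> powr q * vnorm av z powr a) * indicator (pball P av 0 (g + k)) z" for z
  have G [measurable]: "G \<in> borel_measurable \<mu>"
    unfolding G_def by measurable
  define c where "c = D powr \<bar>a\<bar> * ppow k powr - a"
  have c: "c \<ge> 0"
    by (simp add: c_def)
  have pw: "ennreal (\<bar>f (A *v x)\<bar> powr q * vnorm av x powr a) * indicator (pball P av 0 g) x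
      \<le> ennreal c * G (A *v x)" for x
  proof (cases "x \<in> pball P av 0 g \<and> x \<noteq> 0")
    case True
    define t u where "t = vnorm av x" and "u = vnorm av (A *v x) * inverse (ppow k)"
    have up: "vnorm av (A *v x) \<le> ppow k * t"
      using vnorm_mult_vec[of A x] A(2) by (simp add: t_def)
    have ut: "u \<le> t"
      using up ppow_pos[of k] by (simp add: u_def field_simps)
    have "t \<le> b * vnorm av (A *v x)"
      using vnorm_mult_vec[of "matrix_inv A" "A *v x"] by (simp add: t_def b_def matrix_inv_vec[OF A(1)])
    also have "\<dots> \<le> D * inverse (ppow k) * vnorm av (A *v x)"
      by (intro mult_right_mono b) simp
    finally have tu: "t \<le> D * u"
      by (simp add: u_def mult_ac)
    have t0: "t > 0"
      using True by (simp add: t_def vnorm_pos)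
    then have D0: "0 < D * u"
      using tu by linarith
    have "D > 0"
      using P_gt_1 by (simp add: D_def)
    then have u0: "u > 0"
      using D0 by (simp add: zero_less_mult_iff)
    have "t powr a \<le> D powr \<bar>a\<bar> * u powr a"
      by (rule powr_comparable[OF u0 ut tu])
    also have "\<dots> = c * vnorm av (A *v x) powr a"
      by (simp add: c_def u_def powr_mult powr_minus inverse_powr)
    finally have "\<bar>f (A *v x)\<bar> powr q * t powr a \<le> \<bar>f (A *v x)\<bar> powr q * (c * vnorm av (A *v x) powr a)"
      by (rule mult_left_mono) simp
    then have "ennreal (\<bar>f (A *v x)\<bar> powr q * t powr a) \<le> ennreal (c * (\<bar>f (A *v x)\<bar> powr q * vnorm av (A *v x) powr a))"
      by (intro ennreal_leI) (simp add: mult_ac)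
    moreover have "vnorm av (A *v x) \<le> ppow (g + k)"
    proof -
      have "ppow k * t \<le> ppow k * ppow g"
        using True by (intro mult_left_mono) (auto simp: t_def mem_pball)
      then show ?thesis
        using up unfolding ppow_add by (simp add: mult.commute)
    qed
    ultimately show ?thesis
      using True c by (simp add: G_def t_def mem_pball ennreal_mult)
  next
    case False
    have "ennreal (\<bar>f (A *v x)\<bar> powr q * vnorm av x powr a) * indicator (pball P av 0 g) x = 0"
    proof (cases "x = 0")
      case True
      then have "vnorm av x = 0"
        by simp
      then show ?thesis
        by simp
    qed (use False in simp)
    then show ?thesis
      by (simp only: zero_le)
  qed
  have T: "(\<lambda>x. A *v x) \<in> measurable \<mu> \<mu>"
    using matrix_vector_measurable[of "\<lambda>_. A" vborel "\<lambda>x. x"] kborel_const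
    by (simp add: measurable_haar_cong)
  have "(\<integral>\<^sup>+ x\<in>pball P av 0 g. ennreal (\<bar>f (A *v x)\<bar> powr q * vnorm av x powr a) \<partial>\<mu>)
      \<le> (\<integral>\<^sup>+ x. ennreal c * G (A *v x) \<partial>\<mu>)"
    by (intro nn_integral_mono pw)
  also have "\<dots> = ennreal c * (\<integral>\<^sup>+ x. G (A *v x) \<partial>\<mu>)"
    by (rule nn_integral_cmult) (rule measurable_compose[OF T G])
  also have "\<dots> \<le> ennreal c * (ennreal (b ^ CARD('n)) * (\<integral>\<^sup>+ x. G x \<partial>\<mu>))"
    unfolding b_def by (intro mult_left_mono nn_integral_matrix_le A G) simp
  also have "\<dots> \<le> ennreal c * (ennreal ((D * inverse (ppow k)) ^ CARD('n)) * (\<integral>\<^sup>+ x. G x \<partial>\<mu>))"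
    using b by (intro mult_left_mono mult_right_mono ennreal_leI power_mono) auto
  also have "\<dots> = ennreal (c * (D * inverse (ppow k)) ^ CARD('n)) * (\<integral>\<^sup>+ x. G x \<partial>\<mu>)"
    using c P_gt_1 by (subst ennreal_mult) (auto simp: mult.assoc D_def)
  also have "c * (D * inverse (ppow k)) ^ CARD('n) = real P powr (\<nu> * (\<bar>a\<bar> + real CARD('n))) * ppow k powr - (a + real CARD('n))"
  proof -
    have D: "D = real P powr real \<nu>"
      using P_gt_1 by (simp add: D_def powr_realpow)
    have "(D * inverse (ppow k)) ^ CARD('n) = D powr real CARD('n) * ppow k powr - real CARD('n)"
      using P_gt_1 by (subst powr_realpow[symmetric]) (auto simp: D_def powr_mult powr_minus inverse_powr)
    then show ?thesis
      unfolding c_def D by (simp add: powr_powr distrib_left powr_add algebra_simps)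
        (simp add: powr_diff powr_minus powr_add field_simps)
  qed
  finally show ?thesis
    unfolding lqball_def G_def .
qed

end

section \<open>Central Morrey spaces with power weights\<close>

context padic_haar_space
begin

lemma wball_powr:
  assumes "a > - real CARD('n)"
  shows "wball P av \<mu> (\<lambda>x. vnorm av x powr a) k = ball_weight CARD('n) a * ppow k powr (a + real CARD('n))"
proof -
  have "ball_weight CARD('n) a > 0"
    using assms by (intro ball_weight_pos) auto
  then show ?thesis
    unfolding wball_def nn_integral_vnorm_powr[OF assms] by simp
qed

text \<open>Clears roots, weights and \<open>enn2real\<close>, so that later estimates are
  inequalities between integrals in \<open>ennreal\<close>. Finiteness has to be known beforehand
  because \<open>enn2real\<close> sends infinity to 0.\<close>

lemma morrey_quot_le_iff:
  assumes a: "a > - real CARD('n)" and q: "q \<ge> 1" and N: "N \<ge> 0"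
    and fin: "lqball P av \<mu> (\<lambda>x. vnorm av x powr a) q f k < \<infinity>"
  shows "morrey_quot P av \<mu> (\<lambda>x. vnorm av x powr a) q l f k \<le> N \<longleftrightarrow>
    lqball P av \<mu> (\<lambda>x. vnorm av x powr a) q f k
      \<le> ennreal ((N * ball_weight CARD('n) a powr (1 / q + l)) powr q
          * ppow k powr ((a + real CARD('n)) * (1 + l * q)))"
proof -
  define w where "w = ball_weight CARD('n) a"
  have w: "w > 0"
    unfolding w_def using a by (intro ball_weight_pos) auto
  define W where "W = w * ppow k powr (a + real CARD('n))"
  have W: "W > 0"
    using w P_gt_1 by (simp add: W_def)
  obtain L where L: "lqball P av \<mu> (\<lambda>x. vnorm av x powr a) q f k = ennreal L" "L \<ge> 0"
    using fin by (cases "lqball P av \<mu> (\<lambda>x. vnorm av x powr a) q f k") auto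
  have quot: "morrey_quot P av \<mu> (\<lambda>x. vnorm av x powr a) q l f k
      = (W powr (- 1 - l * q) * L) powr (1 / q)"
    unfolding morrey_quot_def wball_powr[OF a] using L by (simp add: W_def w_def)
  define B where "B = W powr (- 1 - l * q) * L"
  have B: "B \<ge> 0"
    using L by (simp add: B_def)
  have "B powr (1 / q) \<le> N \<longleftrightarrow> B \<le> N powr q"
  proof
    assume "B powr (1 / q) \<le> N"
    then have "(B powr (1 / q)) powr q \<le> N powr q"
      using q by (intro powr_mono2) auto
    then show "B \<le> N powr q"
      using q B by (simp add: powr_powr)
  next
    assume "B \<le> N powr q"
    then have "B powr (1 / q) \<le> (N powr q) powr (1 / q)"
      using q B by (intro powr_mono2) auto
    then show "B powr (1 / q) \<le> N"
      using q N by (simp add: powr_powr)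
  qed
  also have "\<dots> \<longleftrightarrow> L \<le> N powr q * W powr (1 + l * q)"
  proof -
    have "- 1 - l * q = - (1 + l * q)"
      by simp
    then have "B = L / W powr (1 + l * q)"
      unfolding B_def by (simp only: powr_minus_divide) simp
    then show ?thesis
      using W by (simp add: pos_divide_le_eq)
  qed
  also have "N powr q * W powr (1 + l * q)
      = (N * w powr (1 / q + l)) powr q * ppow k powr ((a + real CARD('n)) * (1 + l * q))"
  proof -
    have "(1 / q + l) * q = 1 + l * q"
      using q by (simp add: field_simps)
    then show ?thesis
      by (simp add: W_def powr_mult powr_powr mult.assoc)
  qed
  finally show ?thesis
    unfolding quot L(1) B_def[symmetric] w_def[symmetric] by (simp add: ennreal_le_iff)
qed

lemma morrey_quot_nonneg: "morrey_quot P av \<mu> w q l f k \<ge> 0"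
  by (simp add: morrey_quot_def)

lemma morrey_quot_le_norm:
  assumes "in_morrey P av \<mu> w q l f"
  shows "morrey_quot P av \<mu> w q l f k \<le> morrey_norm P av \<mu> w q l f"
  unfolding morrey_norm_def using assms by (intro cSUP_upper) (auto simp: in_morrey_def)

lemma morrey_norm_nonneg:
  assumes "in_morrey P av \<mu> w q l f"
  shows "morrey_norm P av \<mu> w q l f \<ge> 0"
  using morrey_quot_le_norm[OF assms, of 0] morrey_quot_nonneg order_trans by blast

lemma lqball_le_of_morrey:
  assumes a: "a > - real CARD('n)" and q: "q \<ge> 1"
    and f: "in_morrey P av \<mu> (\<lambda>x. vnorm av x powr a) q l f"
    and N: "morrey_norm P av \<mu> (\<lambda>x. vnorm av x powr a) q l f \<le> N"
  shows "lqball P av \<mu> (\<lambda>x. vnorm av x powr a) q f k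
    \<le> ennreal ((N * ball_weight CARD('n) a powr (1 / q + l)) powr q
        * ppow k powr ((a + real CARD('n)) * (1 + l * q)))"
proof -
  have "morrey_quot P av \<mu> (\<lambda>x. vnorm av x powr a) q l f k \<le> N"
    using morrey_quot_le_norm[OF f] N by (rule order_trans)
  moreover have "N \<ge> 0"
    using morrey_norm_nonneg[OF f] N by linarith
  moreover have "lqball P av \<mu> (\<lambda>x. vnorm av x powr a) q f k < \<infinity>"
    using f unfolding in_morrey_def by blast
  ultimately show ?thesis
    using morrey_quot_le_iff[OF a q] by blast
qed

lemma morrey_of_lqball_le:
  assumes a: "a > - real CARD('n)" and q: "q \<ge> 1" and N: "N \<ge> 0"
    and f: "f \<in> borel_measurable \<mu>"
    and le: "\<And>k. lqball P av \<mu> (\<lambda>x. vnorm av x powr a) q f k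
      \<le> ennreal ((N * ball_weight CARD('n) a powr (1 / q + l)) powr q
          * ppow k powr ((a + real CARD('n)) * (1 + l * q)))"
  shows "in_morrey P av \<mu> (\<lambda>x. vnorm av x powr a) q l f"
    and "morrey_norm P av \<mu> (\<lambda>x. vnorm av x powr a) q l f \<le> N"
proof -
  have fin: "lqball P av \<mu> (\<lambda>x. vnorm av x powr a) q f k < \<infinity>" for k
    using le[of k] by (rule le_less_trans) simp
  have quot: "morrey_quot P av \<mu> (\<lambda>x. vnorm av x powr a) q l f k \<le> N" for k
    using morrey_quot_le_iff[OF a q N fin] le by blast
  show "in_morrey P av \<mu> (\<lambda>x. vnorm av x powr a) q l f"
    unfolding in_morrey_def using f fin quot by (auto intro!: bdd_aboveI2)
  show "morrey_norm P av \<mu> (\<lambda>x. vnorm av x powr a) q l f \<le> N"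
    unfolding morrey_norm_def using quot by (intro cSUP_least) auto
qed

end

section \<open>Exponent identities and constants free of the kernel\<close>

locale morrey_exponents = padic_haar_space P av \<mu>
  for P and av :: "'k::field \<Rightarrow> real" and \<mu> :: "('k^'n) measure" +
  fixes m :: nat and qs :: "nat \<Rightarrow> real" and q :: real
    and \<alpha>s :: "nat \<Rightarrow> real" and \<alpha> :: real
    and ls :: "nat \<Rightarrow> real" and l :: real and \<nu> :: nat and d :: real
  assumes m: "m \<ge> 1"
    and q: "q \<ge> 1" and qs: "i < m \<Longrightarrow> qs i \<ge> 1"
    and alpha_gt: "i < m \<Longrightarrow> \<alpha>s i > - d"
    and sum_q: "(\<Sum>i<m. 1 / qs i) = 1 / q"
    and sum_alpha: "(\<Sum>i<m. \<alpha>s i / qs i) = \<alpha> / q"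
    and lambda_gt: "i < m \<Longrightarrow> - 1 / qs i < ls i" and lambda_neg: "i < m \<Longrightarrow> ls i < 0"
    and sum_lambda: "(\<alpha> + d) * l = (\<Sum>i<m. (\<alpha>s i + d) * ls i)"
    and d: "d = real CARD('n)"
begin

text \<open>Plays two roles: the degree of the i-th test function, and the power of the norm of A_i
  by which the i-th Morrey bound scales.\<close>

definition expo :: "nat \<Rightarrow> real" where
  "expo i = (\<alpha>s i + d) * ls i"

text \<open>The constant of \<open>nn_integral_dilation_le\<close> for the weight exponent
  \<open>\<alpha>s i\<close>, that is, the distortion which (DK1) permits.\<close>

definition dil :: "nat \<Rightarrow> real" where
  "dil i = real P powr (real \<nu> * (\<bar>\<alpha>s i\<bar> + d))"

lemma qs_pos: "i < m \<Longrightarrow> qs i > 0"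
  using qs[of i] by simp

lemma dil_pos: "dil i > 0"
  using P_gt_1 by (simp add: dil_def)

lemma sum_q_ratio: "(\<Sum>i<m. q / qs i) = 1"
  using sum_q q sum_distrib_left[of q "\<lambda>i. 1 / qs i" "{..<m}"] by simp

lemma sum_alpha_ratio: "(\<Sum>i<m. \<alpha>s i * (q / qs i)) = \<alpha>"
  using sum_alpha q sum_distrib_left[of q "\<lambda>i. \<alpha>s i / qs i" "{..<m}"] by (simp add: mult.commute)

lemma sum_expo: "(\<Sum>i<m. expo i) = (\<alpha> + d) * l"
  by (simp add: sum_lambda expo_def)

lemma one_plus_lambda_pos: "i < m \<Longrightarrow> 1 + ls i * qs i > 0"
  using lambda_gt[of i] qs_pos[of i] by (simp add: field_simps)

text \<open>The powers of the radius that Hoelder's inequality collects from the m factors add up to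
  the power of the target space; the relation between \<lambda> and the \<lambda>_i enters through
  \<open>sum_expo\<close>.\<close>

lemma sum_exponents: "(\<Sum>i<m. (\<alpha>s i + d) * (1 + ls i * qs i) * (q / qs i)) = (\<alpha> + d) * (1 + l * q)"
proof -
  have "(\<Sum>i<m. (\<alpha>s i + d) * (1 + ls i * qs i) * (q / qs i))
      = (\<Sum>i<m. \<alpha>s i * (q / qs i) + d * (q / qs i) + q * expo i)"
  proof (rule sum.cong[OF refl])
    fix i assume "i \<in> {..<m}"
    then show "(\<alpha>s i + d) * (1 + ls i * qs i) * (q / qs i)
        = \<alpha>s i * (q / qs i) + d * (q / qs i) + q * expo i"
      using qs_pos[of i] by (simp add: expo_def field_simps)
  qed
  also have "\<dots> = \<alpha> + d + q * ((\<alpha> + d) * l)"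
    unfolding sum.distrib sum_distrib_left[symmetric] sum_alpha_ratio sum_q_ratio sum_expo by simp
  finally show ?thesis
    by (simp add: algebra_simps)
qed

text \<open>Inherited from the factors by \<open>sum_exponents\<close>. It makes the q-th power of
  |x|^((\<alpha>+n)\<lambda>) integrable near 0 against the target weight.\<close>

lemma exponent_pos: "(\<alpha> + d) * (1 + l * q) > 0"
proof -
  have "(\<Sum>i<m. (\<alpha>s i + d) * (1 + ls i * qs i) * (q / qs i)) > 0"
  proof (rule sum_pos)
    fix i assume "i \<in> {..<m}"
    then have "\<alpha>s i + d > 0" "1 + ls i * qs i > 0" "q / qs i > 0"
      using alpha_gt[of i] one_plus_lambda_pos[of i] qs_pos[of i] q by auto
    then show "(\<alpha>s i + d) * (1 + ls i * qs i) * (q / qs i) > 0"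
      by (intro mult_pos_pos)
  qed (use m in \<open>auto simp: lessThan_empty_iff\<close>)
  then show ?thesis
    by (simp only: sum_exponents)
qed

text \<open>\<alpha> + n is the average of the \<alpha>_i + n with the weights q/q_i, which sum to
  1.\<close>

lemma alpha_pos: "\<alpha> > - d"
proof -
  have "(\<Sum>i<m. (\<alpha>s i + d) * (q / qs i)) > 0"
  proof (rule sum_pos)
    fix i assume "i \<in> {..<m}"
    then have "\<alpha>s i + d > 0" "q / qs i > 0"
      using alpha_gt[of i] qs_pos[of i] q by auto
    then show "(\<alpha>s i + d) * (q / qs i) > 0"
      by (rule mult_pos_pos)
  qed (use m in \<open>auto simp: lessThan_empty_iff\<close>)
  moreover have "(\<Sum>i<m. (\<alpha>s i + d) * (q / qs i)) = \<alpha> + d"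
    unfolding distrib_right sum.distrib sum_distrib_left[symmetric] sum_alpha_ratio sum_q_ratio by simp
  ultimately show ?thesis
    by simp
qed

text \<open>The dilation losses come from Hoelder's inequality. The \<open>ball_weight\<close>
  factors appear because Morrey norms are normalised by the weight of the ball, whereas the
  estimates count pure powers of its radius.\<close>

definition upper_const :: real where
  "upper_const = (\<Prod>i<m. dil i powr (1 / qs i) * ball_weight d (\<alpha>s i) powr (1 / qs i + ls i))
    / ball_weight d \<alpha> powr (1 / q + l)"

lemma ball_weight_alphas_pos: "i < m \<Longrightarrow> ball_weight d (\<alpha>s i) > 0"
  using alpha_gt by (intro ball_weight_pos) (auto simp: d)

lemma ball_weight_alpha_pos: "ball_weight d \<alpha> > 0"
  using alpha_pos by (intro ball_weight_pos) (auto simp: d)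

lemma upper_const_pos: "upper_const > 0"
proof -
  have "(\<Prod>i<m. dil i powr (1 / qs i) * ball_weight d (\<alpha>s i) powr (1 / qs i + ls i)) > 0"
  proof (rule prod_pos)
    fix i assume "i \<in> {..<m}"
    then have "dil i > 0" "ball_weight d (\<alpha>s i) > 0"
      using dil_pos ball_weight_alphas_pos by auto
    then show "dil i powr (1 / qs i) * ball_weight d (\<alpha>s i) powr (1 / qs i + ls i) > 0"
      by simp
  qed
  then show ?thesis
    using ball_weight_alpha_pos by (simp add: upper_const_def)
qed

text \<open>The Morrey norms of \<open>\<bar>x\<bar>\<^bsup>expo i\<^esup>\<close> in the source spaces and of \<open>\<bar>x\<bar>\<^bsup>(\<alpha>+d)l\<^esup>\<close> in the target space.\<close>

definition source_size :: "nat \<Rightarrow> real" where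
  "source_size i = (ball_weight d (\<alpha>s i + expo i * qs i)
    / ball_weight d (\<alpha>s i) powr (1 + ls i * qs i)) powr (1 / qs i)"

definition target_size :: real where
  "target_size = (ball_weight d (\<alpha> + (\<alpha> + d) * l * q)
    / ball_weight d \<alpha> powr (1 + l * q)) powr (1 / q)"

text \<open>Adding n to the left side gives (\<alpha>_i + n)(1 + \<lambda>_i q_i), so \<lambda>_i >
  -1/q_i is what makes the i-th test function locally admissible.\<close>

lemma source_exponent: "i < m \<Longrightarrow> \<alpha>s i + expo i * qs i > - d"
proof -
  assume i: "i < m"
  have "(\<alpha>s i + d) * (1 + ls i * qs i) > 0"
    using alpha_gt[OF i] one_plus_lambda_pos[OF i] by simp
  then show ?thesis
    by (simp add: expo_def algebra_simps)
qed

lemma target_exponent: "\<alpha> + (\<alpha> + d) * l * q > - d"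
  using exponent_pos by (simp add: algebra_simps)

lemma source_size_pos: "i < m \<Longrightarrow> source_size i > 0"
proof -
  assume i: "i < m"
  have "ball_weight d (\<alpha>s i + expo i * qs i) > 0"
    using source_exponent[OF i] by (intro ball_weight_pos) (auto simp: d)
  then show ?thesis
    using ball_weight_alphas_pos[OF i] by (simp add: source_size_def)
qed

lemma target_size_pos: "target_size > 0"
proof -
  have "ball_weight d (\<alpha> + (\<alpha> + d) * l * q) > 0"
    using target_exponent by (intro ball_weight_pos) (auto simp: d)
  then show ?thesis
    using ball_weight_alpha_pos by (simp add: target_size_def)
qed

text \<open>For this degree of homogeneity the Morrey quotient is the same on every ball, so the
  radius drops out.\<close>

lemma power_function_morrey:
  assumes i: "i < m"
  shows "in_morrey P av \<mu> (\<lambda>x. vnorm av x powr \<alpha>s i) (qs i) (ls i) (\<lambda>x. vnorm av x powr expo i)"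
    and "morrey_norm P av \<mu> (\<lambda>x. vnorm av x powr \<alpha>s i) (qs i) (ls i) (\<lambda>x. vnorm av x powr expo i)
      \<le> source_size i"
proof -
  define v w where "v = ball_weight d (\<alpha>s i + expo i * qs i)" and "w = ball_weight d (\<alpha>s i)"
  have vw: "v > 0" "w > 0"
    unfolding v_def w_def using source_exponent[OF i] ball_weight_alphas_pos[OF i]
    by (auto intro!: ball_weight_pos simp: d)
  have lq: "lqball P av \<mu> (\<lambda>x. vnorm av x powr \<alpha>s i) (qs i) (\<lambda>x. vnorm av x powr expo i) k
      \<le> ennreal ((source_size i * w powr (1 / qs i + ls i)) powr qs i
          * ppow k powr ((\<alpha>s i + d) * (1 + ls i * qs i)))" for k
  proof -
    have "lqball P av \<mu> (\<lambda>x. vnorm av x powr \<alpha>s i) (qs i) (\<lambda>x. vnorm av x powr expo i) k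
        = (\<integral>\<^sup>+ x\<in>pball P av 0 k. ennreal (vnorm av x powr (\<alpha>s i + expo i * qs i)) \<partial>\<mu>)"
      by (simp add: lqball_def powr_powr mult.commute flip: powr_add)
    also have "\<dots> = ennreal (v * ppow k powr (\<alpha>s i + expo i * qs i + d))"
      using nn_integral_vnorm_powr[of "\<alpha>s i + expo i * qs i" k] source_exponent[OF i]
      by (simp add: d v_def)
    also have "\<alpha>s i + expo i * qs i + d = (\<alpha>s i + d) * (1 + ls i * qs i)"
      by (simp add: expo_def algebra_simps)
    also have "v = (source_size i * w powr (1 / qs i + ls i)) powr qs i"
    proof -
      have "(1 / qs i + ls i) * qs i = 1 + ls i * qs i"
        using qs_pos[OF i] by (simp add: field_simps)
      then show ?thesis
        using qs_pos[OF i] vw by (simp add: source_size_def powr_mult powr_powr flip: v_def w_def)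
    qed
    finally show ?thesis
      by simp
  qed
  have "source_size i \<ge> 0"
    using source_size_pos[OF i] by simp
  moreover have "(\<lambda>x. vnorm av x powr expo i) \<in> borel_measurable \<mu>"
    by measurable
  moreover have "\<alpha>s i > - real CARD('n)"
    using alpha_gt[OF i] by (simp add: d)
  ultimately show "in_morrey P av \<mu> (\<lambda>x. vnorm av x powr \<alpha>s i) (qs i) (ls i) (\<lambda>x. vnorm av x powr expo i)"
    "morrey_norm P av \<mu> (\<lambda>x. vnorm av x powr \<alpha>s i) (qs i) (ls i) (\<lambda>x. vnorm av x powr expo i)
      \<le> source_size i"
    using morrey_of_lqball_le[OF _ qs[OF i], of "\<alpha>s i" "source_size i"] lq unfolding w_def d by blast+
qed

end

section \<open>The Hausdorff operator\<close>

locale hausdorff_kernel = morrey_exponents P av \<mu> m qs q \<alpha>s \<alpha> ls l \<nu> d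
  for P and av :: "'k::field \<Rightarrow> real" and \<mu> :: "('k^'n) measure"
    and m qs q \<alpha>s \<alpha> ls l \<nu> d +
  fixes \<Phi> :: "'k^'n \<Rightarrow> real" and A :: "nat \<Rightarrow> 'k^'n \<Rightarrow> 'k^'n^'n"
  assumes Phi [measurable]: "\<Phi> \<in> borel_measurable \<mu>" and Phi_nonneg: "\<Phi> y \<ge> 0"
    and A_measurable: "i < m \<Longrightarrow> kmeasurable P av \<mu> (\<lambda>y. A i y $ r $ s)"
    and A_invertible: "i < m \<Longrightarrow> AE y in \<mu>. invertible (A i y)"
    and A_bounded: "i < m \<Longrightarrow>
      AE y in \<mu>. mnorm av (A i y) * mnorm av (matrix_inv (A i y)) \<le> real P ^ \<nu>"
begin

section \<open>Factorisation of the kernel, joint measurability, Hoelder's inequality\<close>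

definition good :: "'k^'n \<Rightarrow> bool" where
  "good y \<longleftrightarrow> (\<forall>i<m. invertible (A i y) \<and>
    mnorm av (A i y) * mnorm av (matrix_inv (A i y)) \<le> real P ^ \<nu>)"

lemma AE_good: "AE y in \<mu>. good y"
proof -
  have "AE y in \<mu>. \<forall>i\<in>{..<m}. invertible (A i y) \<and>
      mnorm av (A i y) * mnorm av (matrix_inv (A i y)) \<le> real P ^ \<nu>"
    using A_invertible A_bounded by (intro AE_finite_allI) auto
  then show ?thesis
    by (simp add: good_def Ball_def)
qed

text \<open>By (DK1), \<open>\<parallel>A\<^sub>i\<^sup>-\<^sup>1\<parallel>\<close> and \<open>1/\<parallel>A\<^sub>i\<parallel>\<close> agree up to the factor \<open>P\<^sup>\<nu>\<close>; unlike the integrand of \<open>C\<^sub>3\<close>,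
  \<open>kern\<close> is visibly measurable.\<close>

definition kern :: "'k^'n \<Rightarrow> real" where
  "kern y = \<Phi> y / vnorm av y ^ CARD('n) * (\<Prod>i<m. mnorm av (A i y) powr expo i)"

text \<open>The cofactor of \<open>kern\<close> in the absolute value of the kernel, normalised so
  that its local bounds in x are uniform in y.\<close>

definition hprod :: "(nat \<Rightarrow> 'k^'n \<Rightarrow> real) \<Rightarrow> 'k^'n \<Rightarrow> 'k^'n \<Rightarrow> real" where
  "hprod f x y = (\<Prod>i<m. \<bar>f i (A i y *v x)\<bar> * mnorm av (A i y) powr - expo i)"

lemma kern_nonneg: "kern y \<ge> 0"
  by (auto simp: kern_def Phi_nonneg intro!: mult_nonneg_nonneg divide_nonneg_nonneg prod_nonneg)

lemma hprod_nonneg: "hprod f x y \<ge> 0"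
  by (auto simp: hprod_def intro!: prod_nonneg)

lemma good_ppow:
  assumes "good y" "i < m"
  shows "\<exists>k. mnorm av (A i y) = ppow k"
proof -
  have "mnorm av (A i y) \<noteq> 0"
    using mnorm_matrix_inv[of "A i y"] assms by (auto simp: good_def)
  then show ?thesis
    by (rule mnorm_value)
qed

lemma good_mnorm_pos: "good y \<Longrightarrow> i < m \<Longrightarrow> mnorm av (A i y) > 0"
  using good_ppow ppow_pos by metis

lemma abs_hkernel:
  assumes "good y"
  shows "\<bar>hkernel av \<Phi> m A f x y\<bar> = kern y * hprod f x y"
proof -
  have "kern y * hprod f x y = \<Phi> y / vnorm av y ^ CARD('n) *
      (\<Prod>i<m. mnorm av (A i y) powr expo i * (\<bar>f i (A i y *v x)\<bar> * mnorm av (A i y) powr - expo i))"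
    by (simp add: kern_def hprod_def prod.distrib)
  also have "(\<Prod>i<m. mnorm av (A i y) powr expo i * (\<bar>f i (A i y *v x)\<bar> * mnorm av (A i y) powr - expo i))
      = (\<Prod>i<m. \<bar>f i (A i y *v x)\<bar>)"
  proof (rule prod.cong[OF refl])
    fix i assume "i \<in> {..<m}"
    then have "mnorm av (A i y) > 0"
      using good_mnorm_pos[OF assms] by simp
    then have "mnorm av (A i y) powr expo i * mnorm av (A i y) powr - expo i = 1"
      by (simp flip: powr_add)
    then show "mnorm av (A i y) powr expo i * (\<bar>f i (A i y *v x)\<bar> * mnorm av (A i y) powr - expo i)
        = \<bar>f i (A i y *v x)\<bar>"
      by (metis (no_types, opaque_lifting) mult.left_commute mult.right_neutral)
  qed
  finally show ?thesis
    by (simp add: hkernel_def abs_mult abs_prod Phi_nonneg)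
qed

lemma mnorm_A_measurable [measurable]: "i < m \<Longrightarrow> (\<lambda>y. mnorm av (A i y)) \<in> borel_measurable \<mu>"
  using A_measurable by (intro mnorm_measurable) (simp add: kmeasurable_iff)

lemma kern_measurable [measurable]: "kern \<in> borel_measurable \<mu>"
proof -
  have "(\<lambda>y. \<Prod>i<m. mnorm av (A i y) powr expo i) \<in> borel_measurable \<mu>"
    by (intro borel_measurable_prod) auto
  then show ?thesis
    unfolding kern_def by measurable
qed

text \<open>Measurability in both variables together is what exchanging the order of integration
  requires.\<close>

lemma A_joint_measurable: "i < m \<Longrightarrow> (\<lambda>p. A i (snd p) *v fst p) \<in> measurable (\<mu> \<Otimes>\<^sub>M \<mu>) \<mu>"
proof -
  assume i: "i < m"
  have "(\<lambda>p. A i (snd p) $ r $ s) \<in> measurable (\<mu> \<Otimes>\<^sub>M \<mu>) kborel" for r s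
    using A_measurable[OF i, of r s] unfolding kmeasurable_iff
    by (rule measurable_compose[OF measurable_snd])
  moreover have "fst \<in> measurable (\<mu> \<Otimes>\<^sub>M \<mu>) vborel"
    using measurable_fst[of \<mu> \<mu>] by (simp only: measurable_haar_cong)
  ultimately have "(\<lambda>p. A i (snd p) *v fst p) \<in> measurable (\<mu> \<Otimes>\<^sub>M \<mu>) vborel"
    by (rule matrix_vector_measurable)
  then show ?thesis
    by (simp only: measurable_haar_cong(1))
qed

lemma A_section_measurable: "(\<lambda>x. A i y *v x) \<in> measurable \<mu> \<mu>"
  using matrix_vector_measurable[of "\<lambda>_. A i y" vborel "\<lambda>x. x"] kborel_const
  by (simp add: measurable_haar_cong)

lemma hkernel_measurable:
  assumes "\<And>i. i < m \<Longrightarrow> f i \<in> borel_measurable \<mu>"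
  shows "(\<lambda>(x, y). hkernel av \<Phi> m A f x y) \<in> borel_measurable (\<mu> \<Otimes>\<^sub>M \<mu>)"
proof -
  have "(\<lambda>p. f i (A i (snd p) *v fst p)) \<in> borel_measurable (\<mu> \<Otimes>\<^sub>M \<mu>)" if "i < m" for i
    using measurable_compose[OF A_joint_measurable[OF that] assms[OF that]] .
  then have "(\<lambda>p. \<Prod>i<m. f i (A i (snd p) *v fst p)) \<in> borel_measurable (\<mu> \<Otimes>\<^sub>M \<mu>)"
    by (intro borel_measurable_prod) auto
  moreover have "(\<lambda>p. \<Phi> (snd p) / vnorm av (snd p) ^ CARD('n)) \<in> borel_measurable (\<mu> \<Otimes>\<^sub>M \<mu>)"
    by measurable
  ultimately show ?thesis
    unfolding hkernel_def case_prod_beta by (intro borel_measurable_times)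
qed

lemma hprod_measurable:
  assumes "\<And>i. i < m \<Longrightarrow> f i \<in> borel_measurable \<mu>"
  shows "(\<lambda>(x, y). hprod f x y) \<in> borel_measurable (\<mu> \<Otimes>\<^sub>M \<mu>)"
proof -
  have "(\<lambda>p. \<bar>f i (A i (snd p) *v fst p)\<bar> * mnorm av (A i (snd p)) powr - expo i)
      \<in> borel_measurable (\<mu> \<Otimes>\<^sub>M \<mu>)" if "i < m" for i
  proof (intro borel_measurable_times borel_measurable_abs)
    show "(\<lambda>p. f i (A i (snd p) *v fst p)) \<in> borel_measurable (\<mu> \<Otimes>\<^sub>M \<mu>)"
      using measurable_compose[OF A_joint_measurable[OF that] assms[OF that]] .
    have "(\<lambda>p. mnorm av (A i (snd p))) \<in> borel_measurable (\<mu> \<Otimes>\<^sub>M \<mu>)"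
      by (rule measurable_compose[OF measurable_snd mnorm_A_measurable[OF that]])
    then show "(\<lambda>p. mnorm av (A i (snd p)) powr - expo i) \<in> borel_measurable (\<mu> \<Otimes>\<^sub>M \<mu>)"
      by measurable
  qed
  then show ?thesis
    unfolding hprod_def case_prod_beta by (intro borel_measurable_prod) auto
qed

text \<open>Hoelder's inequality for \<open>m\<close> factors, by way of the weighted AM-GM inequality.\<close>

lemma hprod_integral_le:
  assumes y: "good y"
    and f: "\<And>i. i < m \<Longrightarrow> f i \<in> borel_measurable \<mu>"
    and M: "\<And>i. i < m \<Longrightarrow> M i > 0"
    and L: "\<And>i g. i < m \<Longrightarrow> lqball P av \<mu> (\<lambda>x. vnorm av x powr \<alpha>s i) (qs i) (f i) g
      \<le> ennreal (M i powr qs i * ppow g powr ((\<alpha>s i + d) * (1 + ls i * qs i)))"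
  shows "(\<integral>\<^sup>+ x\<in>pball P av 0 g. ennreal (hprod f x y powr q * vnorm av x powr \<alpha>) \<partial>\<mu>)
    \<le> ennreal ((\<Prod>i<m. dil i powr (1 / qs i) * M i) powr q * ppow g powr ((\<alpha> + d) * (1 + l * q)))"
proof -
  obtain k where k: "\<And>i. i < m \<Longrightarrow> mnorm av (A i y) = ppow (k i)"
    using good_ppow[OF y] by metis
  define \<theta> where "\<theta> i = q / qs i" for i
  have \<theta>: "\<theta> i > 0" if "i < m" for i
    using q qs_pos[OF that] by (simp add: \<theta>_def)
  define \<sigma> where "\<sigma> i = (\<alpha>s i + d) * (1 + ls i * qs i)" for i
  \<comment> \<open>\<open>E i\<close> bounds the integral of the i-th normalised factor over the
    ball; dividing by it gives each term of the AM-GM inequality, before weighting, an integral of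
    at most 1.\<close>
  define E where "E i = dil i * M i powr qs i * ppow g powr \<sigma> i" for i
  have E: "E i > 0" if "i < m" for i
    unfolding E_def using M[OF that] dil_pos[of i] P_gt_1 by (intro mult_pos_pos) auto
  define C where "C = (\<Prod>i<m. E i powr \<theta> i)"
  have C0: "C \<ge> 0"
    unfolding C_def by (intro prod_nonneg) simp
  have C_eq: "C = (\<Prod>i<m. dil i powr (1 / qs i) * M i) powr q * ppow g powr ((\<alpha> + d) * (1 + l * q))"
  proof -
    have "C = (\<Prod>i<m. (dil i powr (1 / qs i) * M i) powr q * ppow g powr (\<sigma> i * \<theta> i))"
      unfolding C_def
    proof (rule prod.cong[OF refl])
      fix i assume "i \<in> {..<m}"
      then have "qs i > 0"
        using qs_pos by simp
      then show "E i powr \<theta> i = (dil i powr (1 / qs i) * M i) powr q * ppow g powr (\<sigma> i * \<theta> i)"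
        by (simp add: E_def \<theta>_def powr_mult powr_powr mult.assoc)
    qed
    also have "\<dots> = (\<Prod>i<m. dil i powr (1 / qs i) * M i) powr q * ppow g powr (\<Sum>i<m. \<sigma> i * \<theta> i)"
      unfolding prod_powr_distrib using P_gt_1 by (subst powr_sum) (simp_all add: prod.distrib)
    also have "(\<Sum>i<m. \<sigma> i * \<theta> i) = (\<alpha> + d) * (1 + l * q)"
      unfolding \<sigma>_def \<theta>_def by (rule sum_exponents)
    finally show ?thesis .
  qed
  define t where "t i x = \<bar>f i (A i y *v x)\<bar> powr qs i * vnorm av x powr \<alpha>s i" for i x
  \<comment> \<open>The coefficient of the unnormalised \<open>t i\<close> after the AM-GM
    inequality has been applied to the normalised factors.\<close>
  define b where "b i = C * \<theta> i / E i * ppow (k i) powr - (expo i * qs i)" for i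
  have t0: "t i x \<ge> 0" for i x
    by (simp add: t_def)
  have b0: "b i \<ge> 0" if "i < m" for i
    unfolding b_def using C0 \<theta>[OF that] E[OF that] by (intro mult_nonneg_nonneg divide_nonneg_nonneg) auto
  have pw: "hprod f x y powr q * vnorm av x powr \<alpha> \<le> (\<Sum>i<m. b i * t i x)" for x
  proof (cases "x = 0")
    case True
    moreover have "(\<Sum>i<m. b i * t i x) \<ge> 0"
      by (intro sum_nonneg mult_nonneg_nonneg t0) (simp add: b0)
    ultimately show ?thesis
      by simp
  next
    case False
    define u where "u i = t i x * ppow (k i) powr - (expo i * qs i)" for i
    have u0: "u i \<ge> 0" for i
      by (simp add: u_def t0)
    have x0: "vnorm av x \<noteq> 0"
      using False by simp
    have "(\<Sum>i<m. \<alpha>s i * \<theta> i) = \<alpha>"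
      unfolding \<theta>_def by (rule sum_alpha_ratio)
    then have x_powr: "vnorm av x powr \<alpha> = (\<Prod>i<m. vnorm av x powr (\<alpha>s i * \<theta> i))"
      using powr_sum[OF x0, of "\<lambda>i. \<alpha>s i * \<theta> i" "{..<m}"] by (simp only:)
    have "hprod f x y powr q * vnorm av x powr \<alpha>
        = (\<Prod>i<m. (\<bar>f i (A i y *v x)\<bar> * mnorm av (A i y) powr - expo i) powr q * vnorm av x powr (\<alpha>s i * \<theta> i))"
      unfolding x_powr hprod_def prod_powr_distrib by (rule prod.distrib[symmetric])
    also have "\<dots> = (\<Prod>i<m. u i powr \<theta> i)"
    proof (rule prod.cong[OF refl])
      fix i assume "i \<in> {..<m}"
      then have i: "i < m" "qs i > 0"
        using qs_pos by auto
      then have "qs i * \<theta> i = q" "expo i * qs i * \<theta> i = expo i * q"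
        by (simp_all add: \<theta>_def)
      then show "(\<bar>f i (A i y *v x)\<bar> * mnorm av (A i y) powr - expo i) powr q * vnorm av x powr (\<alpha>s i * \<theta> i)
          = u i powr \<theta> i"
        unfolding k[OF i(1)] u_def t_def powr_mult powr_powr[of "ppow _"] powr_powr[of "\<bar>_\<bar>"]
          powr_powr[of "vnorm _ _"] minus_mult_left[symmetric]
        by (simp only: mult_ac)
    qed
    also have "\<dots> = C * (\<Prod>i<m. (u i / E i) powr \<theta> i)"
    proof -
      have "u i powr \<theta> i = E i powr \<theta> i * (u i / E i) powr \<theta> i" if "i \<in> {..<m}" for i
      proof -
        have "E i > 0"
          using E that by simp
        then show ?thesis
          by (simp flip: powr_mult)
      qed
      then show ?thesis
        unfolding C_def prod.distrib[symmetric] by (intro prod.cong) auto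
    qed
    also have "\<dots> \<le> C * (\<Sum>i<m. \<theta> i * (u i / E i))"
    proof (intro mult_left_mono weighted_arith_geom_mean C0)
      show "(\<Sum>i<m. \<theta> i) = 1"
        by (simp add: \<theta>_def sum_q_ratio)
      show "0 \<le> u i / E i" if "i \<in> {..<m}" for i
        using u0[of i] E[of i] that by simp
    qed (use \<theta> in auto)
    also have "\<dots> = (\<Sum>i<m. b i * t i x)"
      by (simp add: sum_distrib_left b_def u_def mult_ac)
    finally show ?thesis .
  qed
  have tm [measurable]: "t i \<in> borel_measurable \<mu>" if "i < m" for i
  proof -
    have [measurable]: "(\<lambda>x. f i (A i y *v x)) \<in> borel_measurable \<mu>"
      by (rule measurable_compose[OF A_section_measurable f[OF that]])
    show ?thesis
      unfolding t_def by measurable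
  qed
  have int_t: "ennreal (b i) * (\<integral>\<^sup>+ x\<in>pball P av 0 g. ennreal (t i x) \<partial>\<mu>) \<le> ennreal (C * \<theta> i)"
    if i: "i < m" for i
  proof -
    have inv: "invertible (A i y)" "mnorm av (A i y) * mnorm av (matrix_inv (A i y)) \<le> real P ^ \<nu>"
      using y i by (auto simp: good_def)
    have "(\<integral>\<^sup>+ x\<in>pball P av 0 g. ennreal (t i x) \<partial>\<mu>)
        \<le> ennreal (dil i * ppow (k i) powr - (\<alpha>s i + d))
          * lqball P av \<mu> (\<lambda>x. vnorm av x powr \<alpha>s i) (qs i) (f i) (g + k i)"
      using nn_integral_dilation_le[where g = g and q = "qs i" and a = "\<alpha>s i", OF inv(1) k[OF i] inv(2) f[OF i]]
      unfolding t_def dil_def d[symmetric] .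
    also have "\<dots> \<le> ennreal (dil i * ppow (k i) powr - (\<alpha>s i + d))
          * ennreal (M i powr qs i * ppow (g + k i) powr \<sigma> i)"
      unfolding \<sigma>_def by (intro mult_left_mono L[OF i]) simp
    also have "\<dots> = ennreal (dil i * ppow (k i) powr - (\<alpha>s i + d) * (M i powr qs i * ppow (g + k i) powr \<sigma> i))"
      using dil_pos[of i] by (intro ennreal_mult[symmetric]) auto
    also have "dil i * ppow (k i) powr - (\<alpha>s i + d) * (M i powr qs i * ppow (g + k i) powr \<sigma> i)
        = E i * (ppow (k i) powr - (\<alpha>s i + d) * ppow (k i) powr \<sigma> i)"
      unfolding ppow_add powr_mult E_def by (simp only: mult_ac)
    \<comment> \<open>Jacobian, weight and enlarged ball together leave exactly the power of the
      norm of A_i that the normalisation in \<open>hprod\<close> cancels.\<close>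
    also have "ppow (k i) powr - (\<alpha>s i + d) * ppow (k i) powr \<sigma> i = ppow (k i) powr (expo i * qs i)"
    proof -
      have "- (\<alpha>s i + d) + \<sigma> i = expo i * qs i"
        by (simp add: \<sigma>_def expo_def algebra_simps)
      then show ?thesis
        by (simp only: powr_add[symmetric])
    qed
    finally have le: "(\<integral>\<^sup>+ x\<in>pball P av 0 g. ennreal (t i x) \<partial>\<mu>) \<le> ennreal (E i * ppow (k i) powr (expo i * qs i))" .
    have "ppow (k i) powr - (expo i * qs i) * ppow (k i) powr (expo i * qs i) = 1"
      using ppow_pos[of "k i"] by (subst powr_add[symmetric]) simp
    then have eq: "b i * (E i * ppow (k i) powr (expo i * qs i)) = C * \<theta> i"
      using E[OF i] by (simp add: b_def mult.assoc)
    have "ennreal (b i) * (\<integral>\<^sup>+ x\<in>pball P av 0 g. ennreal (t i x) \<partial>\<mu>)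
        \<le> ennreal (b i) * ennreal (E i * ppow (k i) powr (expo i * qs i))"
      by (intro mult_left_mono le) simp
    also have "\<dots> = ennreal (b i * (E i * ppow (k i) powr (expo i * qs i)))"
      by (rule ennreal_mult'[OF b0[OF i], symmetric])
    finally show ?thesis
      unfolding eq .
  qed
  have "(\<integral>\<^sup>+ x\<in>pball P av 0 g. ennreal (hprod f x y powr q * vnorm av x powr \<alpha>) \<partial>\<mu>)
      \<le> (\<integral>\<^sup>+ x. (\<Sum>i<m. ennreal (b i) * (ennreal (t i x) * indicator (pball P av 0 g) x)) \<partial>\<mu>)"
  proof (rule nn_integral_mono)
    fix x
    have "ennreal (hprod f x y powr q * vnorm av x powr \<alpha>) \<le> ennreal (\<Sum>i<m. b i * t i x)"
      by (intro ennreal_leI pw)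
    also have "\<dots> = (\<Sum>i<m. ennreal (b i) * ennreal (t i x))"
      using b0 t0 by (subst sum_ennreal[symmetric]) (auto simp: ennreal_mult)
    finally show "ennreal (hprod f x y powr q * vnorm av x powr \<alpha>) * indicator (pball P av 0 g) x
        \<le> (\<Sum>i<m. ennreal (b i) * (ennreal (t i x) * indicator (pball P av 0 g) x))"
      by (simp add: mult.assoc[symmetric] sum_distrib_right[symmetric] mult_right_mono)
  qed
  also have "\<dots> = (\<Sum>i<m. ennreal (b i) * (\<integral>\<^sup>+ x\<in>pball P av 0 g. ennreal (t i x) \<partial>\<mu>))"
    by (subst nn_integral_sum) (auto intro!: sum.cong nn_integral_cmult)
  also have "\<dots> \<le> (\<Sum>i<m. ennreal (C * \<theta> i))"
    by (intro sum_mono int_t) simp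
  also have "\<dots> = ennreal (\<Sum>i<m. C * \<theta> i)"
    using C0 \<theta> by (intro sum_ennreal) (auto intro: mult_nonneg_nonneg less_imp_le)
  also have "(\<Sum>i<m. C * \<theta> i) = C"
    unfolding sum_distrib_left[symmetric] \<theta>_def sum_q_ratio by simp
  finally show ?thesis
    unfolding C_eq .
qed

end

context morrey_exponents
begin

definition cmp_const :: real where
  "cmp_const = (\<Prod>i<m. (real P ^ \<nu>) powr \<bar>expo i\<bar>)"

lemma cmp_const_pos: "cmp_const > 0"
  unfolding cmp_const_def using P_gt_1 by (intro prod_pos) auto

end

context hausdorff_kernel
begin

section \<open>Absolute convergence and the upper bound\<close>

lemma hausdorff_op_measurable:
  assumes "\<And>i. i < m \<Longrightarrow> f i \<in> borel_measurable \<mu>"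
  shows "hausdorff_op av \<mu> \<Phi> m A f \<in> borel_measurable \<mu>"
  unfolding hausdorff_op_def
  by (intro borel_measurable_lebesgue_integral hkernel_measurable assms)

text \<open>\<open>R\<close> is the q-th moment in y for the measure \<open>kern\<close> dy.
  Fubini's theorem and the bound uniform in y control its weighted integral over balls. Jensen's
  inequality gives |H f|^q \<le> T^(q-1) R wherever R is finite, together with absolute convergence,
  and integrating R supplies the missing factor T.\<close>

lemma hausdorff_estimate:
  assumes f: "\<And>i. i < m \<Longrightarrow> f i \<in> borel_measurable \<mu>"
    and M: "\<And>i. i < m \<Longrightarrow> M i > 0"
    and L: "\<And>i g. i < m \<Longrightarrow> lqball P av \<mu> (\<lambda>x. vnorm av x powr \<alpha>s i) (qs i) (f i) g
      \<le> ennreal (M i powr qs i * ppow g powr ((\<alpha>s i + d) * (1 + ls i * qs i)))"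
    and T: "(\<integral>\<^sup>+ y. ennreal (kern y) \<partial>\<mu>) = ennreal T" "T \<ge> 0"
  shows "AE x in \<mu>. integrable \<mu> (hkernel av \<Phi> m A f x)"
    and "lqball P av \<mu> (\<lambda>x. vnorm av x powr \<alpha>) q (hausdorff_op av \<mu> \<Phi> m A f) g
      \<le> ennreal ((T * (\<Prod>i<m. dil i powr (1 / qs i) * M i)) powr q * ppow g powr ((\<alpha> + d) * (1 + l * q)))"
proof -
  have pair: "pair_sigma_finite \<mu> \<mu>" ..
  define X where "X = (\<Prod>i<m. dil i powr (1 / qs i) * M i)"
  have X0: "X \<ge> 0"
    unfolding X_def using M by (intro prod_nonneg mult_nonneg_nonneg) (auto intro: less_imp_le)
  define E where "E g = X powr q * ppow g powr ((\<alpha> + d) * (1 + l * q))" for g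
  have E0: "E g \<ge> 0" for g
    by (simp add: E_def)
  define R where "R x = (\<integral>\<^sup>+ y. ennreal (kern y * hprod f x y powr q) \<partial>\<mu>)" for x
  have hm [measurable]: "(\<lambda>p. hprod f (fst p) (snd p)) \<in> borel_measurable (\<mu> \<Otimes>\<^sub>M \<mu>)"
    using hprod_measurable[of f] f by (simp add: case_prod_beta')
  have hmx: "(\<lambda>y. hprod f x y) \<in> borel_measurable \<mu>" for x
    using measurable_compose[OF measurable_Pair1' hm, of x] by simp
  have hmy [measurable]: "(\<lambda>x. hprod f x y) \<in> borel_measurable \<mu>" for y
    using measurable_compose[OF measurable_Pair2' hm, of y] by simp
  have Rm [measurable]: "R \<in> borel_measurable \<mu>"
    unfolding R_def by (rule borel_measurable_nn_integral) (simp add: case_prod_beta')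
  have R_int: "(\<integral>\<^sup>+ x\<in>pball P av 0 g. R x * ennreal (vnorm av x powr \<alpha>) \<partial>\<mu>) \<le> ennreal (T * E g)" for g
  proof -
    have "(\<integral>\<^sup>+ x\<in>pball P av 0 g. R x * ennreal (vnorm av x powr \<alpha>) \<partial>\<mu>)
        = (\<integral>\<^sup>+ x. \<integral>\<^sup>+ y. ennreal (kern y * hprod f x y powr q) *
            (ennreal (vnorm av x powr \<alpha>) * indicator (pball P av 0 g) x) \<partial>\<mu> \<partial>\<mu>)"
      unfolding R_def mult.assoc
      by (intro nn_integral_cong nn_integral_multc[symmetric]) (use hmx in measurable)
    also have "\<dots> = (\<integral>\<^sup>+ y. \<integral>\<^sup>+ x. ennreal (kern y * hprod f x y powr q) *
            (ennreal (vnorm av x powr \<alpha>) * indicator (pball P av 0 g) x) \<partial>\<mu> \<partial>\<mu>)"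
      by (rule pair_sigma_finite.Fubini'[OF pair, symmetric]) (simp add: case_prod_beta')
    also have "\<dots> \<le> (\<integral>\<^sup>+ y. ennreal (kern y) * ennreal (E g) \<partial>\<mu>)"
    proof (rule nn_integral_mono_AE)
      show "AE y in \<mu>. (\<integral>\<^sup>+ x. ennreal (kern y * hprod f x y powr q) *
            (ennreal (vnorm av x powr \<alpha>) * indicator (pball P av 0 g) x) \<partial>\<mu>) \<le> ennreal (kern y) * ennreal (E g)"
        using AE_good
      proof eventually_elim
        case (elim y)
        have "(\<integral>\<^sup>+ x. ennreal (kern y * hprod f x y powr q) *
              (ennreal (vnorm av x powr \<alpha>) * indicator (pball P av 0 g) x) \<partial>\<mu>)
            = (\<integral>\<^sup>+ x. ennreal (kern y) * (ennreal (hprod f x y powr q * vnorm av x powr \<alpha>) * indicator (pball P av 0 g) x) \<partial>\<mu>)"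
          by (intro nn_integral_cong) (simp add: ennreal_mult kern_nonneg mult_ac)
        also have "\<dots> = ennreal (kern y) * (\<integral>\<^sup>+ x\<in>pball P av 0 g. ennreal (hprod f x y powr q * vnorm av x powr \<alpha>) \<partial>\<mu>)"
          by (rule nn_integral_cmult) measurable
        also have "\<dots> \<le> ennreal (kern y) * ennreal (E g)"
          unfolding E_def X_def using elim by (intro mult_left_mono hprod_integral_le f M L) auto
        finally show ?case .
      qed
    qed
    also have "\<dots> = ennreal (T * E g)"
      using T E0 by (simp add: nn_integral_multc ennreal_mult)
    finally show ?thesis .
  qed
  \<comment> \<open>A finite integral over each ball of a countable exhaustion makes R finite almost
    everywhere, once the weight, which is positive off the origin, is divided out.\<close>
  have "AE x in \<mu>. R x * ennreal (vnorm av x powr \<alpha>) * indicator (pball P av 0 (int i)) x \<noteq> \<infinity>" for i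
  proof (rule nn_integral_PInf_AE)
    have "(\<integral>\<^sup>+ x. R x * ennreal (vnorm av x powr \<alpha>) * indicator (pball P av 0 (int i)) x \<partial>\<mu>) < \<infinity>"
      using R_int[of "int i"] by (rule le_less_trans) simp
    then show "(\<integral>\<^sup>+ x. R x * ennreal (vnorm av x powr \<alpha>) * indicator (pball P av 0 (int i)) x \<partial>\<mu>) \<noteq> \<infinity>"
      by simp
  qed measurable
  then have "AE x in \<mu>. \<forall>i. R x * ennreal (vnorm av x powr \<alpha>) * indicator (pball P av 0 (int i)) x \<noteq> \<infinity>"
    by (simp add: AE_all_countable)
  then have AE_R: "AE x in \<mu>. R x \<noteq> \<infinity>"
    using AE_nonzero
  proof eventually_elim
    case (elim x)
    obtain i where i: "x \<in> pball P av 0 (int i)"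
      using pball_cover by blast
    have "vnorm av x powr \<alpha> > 0"
      using elim by simp
    then have "ennreal (vnorm av x powr \<alpha>) \<noteq> 0"
      by (simp add: ennreal_eq_0_iff not_le)
    moreover have "R x * ennreal (vnorm av x powr \<alpha>) \<noteq> \<infinity>"
      using elim(1)[rule_format, of i] i by simp
    ultimately show ?case
      by (auto simp: ennreal_top_mult)
  qed
  have abs_hk: "(\<integral>\<^sup>+ y. ennreal (norm (hkernel av \<Phi> m A f x y)) \<partial>\<mu>) = (\<integral>\<^sup>+ y. ennreal (kern y * hprod f x y) \<partial>\<mu>)" for x
    using AE_good by (intro nn_integral_cong_AE) (auto elim!: eventually_mono simp: abs_hkernel)
  have bound: "(\<integral>\<^sup>+ y. ennreal (norm (hkernel av \<Phi> m A f x y)) \<partial>\<mu>)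
      \<le> ennreal ((T powr (q - 1) * enn2real (R x)) powr (1 / q))" if "R x \<noteq> \<infinity>" for x
    unfolding abs_hk
  proof (rule nn_integral_weighted_le[OF kern_measurable hmx kern_nonneg hprod_nonneg q T])
    show "(\<integral>\<^sup>+ y. ennreal (kern y * hprod f x y powr q) \<partial>\<mu>) = ennreal (enn2real (R x))"
      unfolding R_def[symmetric] using that by (simp add: less_top)
  qed simp
  have hk_m: "hkernel av \<Phi> m A f x \<in> borel_measurable \<mu>" for x
    using measurable_compose[OF measurable_Pair1' hkernel_measurable[of f], of x] f by simp
  have int: "integrable \<mu> (hkernel av \<Phi> m A f x)" if "R x \<noteq> \<infinity>" for x
    using hk_m le_less_trans[OF bound[OF that]] by (intro integrableI_bounded) auto
  then show "AE x in \<mu>. integrable \<mu> (hkernel av \<Phi> m A f x)"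
    using AE_R by (auto elim: eventually_mono)
  have H_le: "\<bar>hausdorff_op av \<mu> \<Phi> m A f x\<bar> powr q \<le> T powr (q - 1) * enn2real (R x)" if "R x \<noteq> \<infinity>" for x
  proof -
    have "ennreal (norm (hausdorff_op av \<mu> \<Phi> m A f x)) \<le> ennreal ((T powr (q - 1) * enn2real (R x)) powr (1 / q))"
      unfolding hausdorff_op_def
      using integral_norm_bound_ennreal[OF int[OF that]] bound[OF that] by (rule order_trans)
    then have "\<bar>hausdorff_op av \<mu> \<Phi> m A f x\<bar> \<le> (T powr (q - 1) * enn2real (R x)) powr (1 / q)"
      by (simp add: ennreal_le_iff)
    then have "\<bar>hausdorff_op av \<mu> \<Phi> m A f x\<bar> powr q \<le> ((T powr (q - 1) * enn2real (R x)) powr (1 / q)) powr q"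
      using q by (intro powr_mono2) auto
    then show ?thesis
      using q by (simp add: powr_powr)
  qed
  have "lqball P av \<mu> (\<lambda>x. vnorm av x powr \<alpha>) q (hausdorff_op av \<mu> \<Phi> m A f) g
      \<le> (\<integral>\<^sup>+ x. ennreal (T powr (q - 1)) * (R x * ennreal (vnorm av x powr \<alpha>) * indicator (pball P av 0 g) x) \<partial>\<mu>)"
    unfolding lqball_def
  proof (rule nn_integral_mono_AE)
    show "AE x in \<mu>. ennreal (\<bar>hausdorff_op av \<mu> \<Phi> m A f x\<bar> powr q * vnorm av x powr \<alpha>) * indicator (pball P av 0 g) x
        \<le> ennreal (T powr (q - 1)) * (R x * ennreal (vnorm av x powr \<alpha>) * indicator (pball P av 0 g) x)"
      using AE_R
    proof eventually_elim
      case (elim x)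
      have "\<bar>hausdorff_op av \<mu> \<Phi> m A f x\<bar> powr q * vnorm av x powr \<alpha>
          \<le> T powr (q - 1) * enn2real (R x) * vnorm av x powr \<alpha>"
        using H_le[OF elim] by (rule mult_right_mono) simp
      then have "ennreal (\<bar>hausdorff_op av \<mu> \<Phi> m A f x\<bar> powr q * vnorm av x powr \<alpha>)
          \<le> ennreal (T powr (q - 1)) * (ennreal (enn2real (R x)) * ennreal (vnorm av x powr \<alpha>))"
        by (simp add: mult.assoc ennreal_leI flip: ennreal_mult)
      also have "ennreal (enn2real (R x)) = R x"
        using elim by (simp add: less_top)
      finally show ?case
        unfolding mult.assoc[symmetric] by (rule mult_right_mono) simp
    qed
  qed
  also have "\<dots> = ennreal (T powr (q - 1)) * (\<integral>\<^sup>+ x\<in>pball P av 0 g. R x * ennreal (vnorm av x powr \<alpha>) \<partial>\<mu>)"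
    by (rule nn_integral_cmult) measurable
  also have "\<dots> \<le> ennreal (T powr (q - 1)) * ennreal (T * E g)"
    by (intro mult_left_mono R_int) simp
  also have "\<dots> = ennreal (T powr (q - 1) * (T * E g))"
    by (rule ennreal_mult'[symmetric]) simp
  also have "T powr (q - 1) * (T * E g) = (T * X) powr q * ppow g powr ((\<alpha> + d) * (1 + l * q))"
  proof (cases "T = 0")
    case False
    then have "T powr (q - 1) * T = T powr q"
      using T by (simp add: powr_diff)
    then have "T powr (q - 1) * (T * E g) = T powr q * E g"
      by (simp flip: mult.assoc)
    then show ?thesis
      unfolding E_def powr_mult by (simp only: mult_ac)
  qed simp
  finally show "lqball P av \<mu> (\<lambda>x. vnorm av x powr \<alpha>) q (hausdorff_op av \<mu> \<Phi> m A f) g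
      \<le> ennreal ((T * (\<Prod>i<m. dil i powr (1 / qs i) * M i)) powr q * ppow g powr ((\<alpha> + d) * (1 + l * q)))"
    unfolding X_def .
qed

abbreviation weights :: "nat \<Rightarrow> 'k^'n \<Rightarrow> real" where
  "weights \<equiv> (\<lambda>i x. vnorm av x powr \<alpha>s i)"

abbreviation weight :: "'k^'n \<Rightarrow> real" where
  "weight \<equiv> (\<lambda>x. vnorm av x powr \<alpha>)"

text \<open>The estimate divides by the norms of the \<open>f\<^sub>i\<close>, which may vanish: enlarge them by \<open>\<epsilon>\<close> and let \<open>\<epsilon> \<rightarrow> 0\<close>.\<close>

lemma hbound_upper:
  assumes T: "(\<integral>\<^sup>+ y. ennreal (kern y) \<partial>\<mu>) = ennreal T" "T \<ge> 0"
  shows "hbound P av \<mu> \<Phi> m A weights qs ls weight q l (upper_const * T)"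
  unfolding hbound_def
proof (intro conjI allI impI)
  show "0 \<le> upper_const * T"
    using upper_const_pos T by simp
next
  fix f assume f: "\<forall>i<m. in_morrey P av \<mu> (weights i) (qs i) (ls i) (f i)"
  define N where "N i = morrey_norm P av \<mu> (weights i) (qs i) (ls i) (f i)" for i
  have N0: "N i \<ge> 0" if "i < m" for i
    unfolding N_def using f that by (intro morrey_norm_nonneg) auto
  have fm: "f i \<in> borel_measurable \<mu>" if "i < m" for i
    using f that by (auto simp: in_morrey_def)
  let ?H = "hausdorff_op av \<mu> \<Phi> m A f"
  have main: "(AE x in \<mu>. integrable \<mu> (hkernel av \<Phi> m A f x)) \<and> in_morrey P av \<mu> weight q l ?H \<and>
      morrey_norm P av \<mu> weight q l ?H \<le> upper_const * T * (\<Prod>i<m. N i + \<epsilon>)" if \<epsilon>: "\<epsilon> > 0" for \<epsilon>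
  proof -
    define M where "M i = (N i + \<epsilon>) * ball_weight d (\<alpha>s i) powr (1 / qs i + ls i)" for i
    have M: "M i > 0" if "i < m" for i
      unfolding M_def using N0[OF that] \<epsilon> ball_weight_alphas_pos[OF that] by (intro mult_pos_pos) auto
    have L: "lqball P av \<mu> (weights i) (qs i) (f i) g
        \<le> ennreal (M i powr qs i * ppow g powr ((\<alpha>s i + d) * (1 + ls i * qs i)))" if i: "i < m" for i g
    proof -
      have "\<alpha>s i > - real CARD('n)"
        using alpha_gt[OF i] by (simp add: d)
      then show ?thesis
        using lqball_le_of_morrey[of "\<alpha>s i" "qs i" "ls i" "f i" "N i + \<epsilon>" g] qs[OF i] f i \<epsilon>
        unfolding M_def N_def d by simp
    qed
    define N' where "N' = upper_const * T * (\<Prod>i<m. N i + \<epsilon>)"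
    have N': "N' \<ge> 0"
      unfolding N'_def using upper_const_pos T N0 \<epsilon>
      by (intro mult_nonneg_nonneg prod_nonneg) (auto intro: add_nonneg_nonneg less_imp_le)
    \<comment> \<open>\<open>upper_const\<close> is chosen to make this identity true: the estimate
      then has the shape from which a Morrey norm of at most \<open>N'\<close> is read off.\<close>
    have eq: "T * (\<Prod>i<m. dil i powr (1 / qs i) * M i) = N' * ball_weight d \<alpha> powr (1 / q + l)"
      using ball_weight_alpha_pos
      by (simp add: N'_def upper_const_def M_def prod.distrib)
    have a: "\<alpha> > - real CARD('n)"
      using alpha_pos by (simp add: d)
    have H: "lqball P av \<mu> weight q ?H g
        \<le> ennreal ((N' * ball_weight (real CARD('n)) \<alpha> powr (1 / q + l)) powr q
          * ppow g powr ((\<alpha> + real CARD('n)) * (1 + l * q)))" for g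
      using hausdorff_estimate(2)[where g = g, OF fm M L T] unfolding eq d[symmetric] .
    show ?thesis
      using hausdorff_estimate(1)[of f M T] fm M L T
        morrey_of_lqball_le[OF a q N' hausdorff_op_measurable[OF fm] H]
      unfolding N'_def by simp
  qed
  from main[of 1] show "AE x in \<mu>. integrable \<mu> (hkernel av \<Phi> m A f x)" "in_morrey P av \<mu> weight q l ?H"
    by simp_all
  have "((\<lambda>\<epsilon>. upper_const * T * (\<Prod>i<m. N i + \<epsilon>)) \<longlongrightarrow> upper_const * T * (\<Prod>i<m. N i + 0)) (at_right 0)"
    by (intro tendsto_intros)
  moreover have "eventually (\<lambda>\<epsilon>. morrey_norm P av \<mu> weight q l ?H \<le> upper_const * T * (\<Prod>i<m. N i + \<epsilon>)) (at_right 0)"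
    using eventually_at_right_less[of "0::real"] by eventually_elim (use main in blast)
  ultimately have "morrey_norm P av \<mu> weight q l ?H \<le> upper_const * T * (\<Prod>i<m. N i + 0)"
    by (rule tendsto_lowerbound) simp
  then show "morrey_norm P av \<mu> weight q l ?H
      \<le> upper_const * T * (\<Prod>i<m. morrey_norm P av \<mu> (weights i) (qs i) (ls i) (f i))"
    by (simp add: N_def)
qed

section \<open>The lower bound from power functions\<close>

lemma hkernel_power_ge:
  assumes y: "good y" and x: "x \<noteq> 0"
  shows "kern y * vnorm av x powr ((\<alpha> + d) * l) \<le> hkernel av \<Phi> m A (\<lambda>i x. vnorm av x powr expo i) x y"
proof -
  have x0: "vnorm av x \<noteq> 0"
    using x by simp
  have "kern y * vnorm av x powr ((\<alpha> + d) * l)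
      = \<Phi> y / vnorm av y ^ CARD('n) * (\<Prod>i<m. (mnorm av (A i y) * vnorm av x) powr expo i)"
    unfolding kern_def sum_expo[symmetric] powr_sum[OF x0] powr_mult prod.distrib by (simp only: mult.assoc)
  also have "\<dots> \<le> \<Phi> y / vnorm av y ^ CARD('n) * (\<Prod>i<m. vnorm av (A i y *v x) powr expo i)"
  proof (intro mult_left_mono prod_mono conjI)
    fix i assume "i \<in> {..<m}"
    then have i: "i < m"
      by simp
    then have inv: "invertible (A i y)"
      using y by (simp add: good_def)
    have "A i y *v x \<noteq> 0"
      using matrix_inv_vec(1)[OF inv, of x] x by (metis matrix_vector_mult_0_right)
    moreover have "expo i \<le> 0"
      using alpha_gt[OF i] lambda_neg[OF i] by (auto simp: expo_def mult_le_0_iff)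
    ultimately show "(mnorm av (A i y) * vnorm av x) powr expo i \<le> vnorm av (A i y *v x) powr expo i"
      by (intro powr_mono2' vnorm_mult_vec vnorm_pos)
  qed (use Phi_nonneg in auto)
  finally show ?thesis
    by (simp add: hkernel_def)
qed

text \<open>With T the mass of \<open>kern\<close>, the image of the test functions is at least T
  |x|^((\<alpha>+n)\<lambda>). That power has the same Morrey quotient on every ball, so testing on
  the unit ball yields the whole factor \<open>target_size\<close>.\<close>

lemma hbound_lower:
  assumes C: "hbound P av \<mu> \<Phi> m A weights qs ls weight q l C"
  shows "(\<integral>\<^sup>+ y. ennreal (kern y) \<partial>\<mu>) \<le> ennreal (C * (\<Prod>i<m. source_size i) / target_size)"
proof -
  let ?f = "\<lambda>i x. vnorm av x powr expo i"
  let ?H = "hausdorff_op av \<mu> \<Phi> m A ?f"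
  have C0: "C \<ge> 0"
    using C by (simp add: hbound_def)
  have source: "\<forall>i<m. in_morrey P av \<mu> (weights i) (qs i) (ls i) (?f i)"
    using power_function_morrey(1) by (intro allI impI)
  have int: "AE x in \<mu>. integrable \<mu> (hkernel av \<Phi> m A ?f x)"
    and H: "in_morrey P av \<mu> weight q l ?H"
    and norm: "morrey_norm P av \<mu> weight q l ?H
      \<le> C * (\<Prod>i<m. morrey_norm P av \<mu> (weights i) (qs i) (ls i) (?f i))"
    using C[unfolded hbound_def, THEN conjunct2, rule_format, of ?f] source by (simp_all only: simp_thms)
  have ge: "(\<integral>\<^sup>+ y. ennreal (kern y) \<partial>\<mu>) * ennreal (vnorm av x powr ((\<alpha> + d) * l)) \<le> ennreal (?H x)"
    if x: "x \<noteq> 0" "integrable \<mu> (hkernel av \<Phi> m A ?f x)" for x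
  proof -
    have "(\<integral>\<^sup>+ y. ennreal (kern y) \<partial>\<mu>) * ennreal (vnorm av x powr ((\<alpha> + d) * l))
        = (\<integral>\<^sup>+ y. ennreal (kern y) * ennreal (vnorm av x powr ((\<alpha> + d) * l)) \<partial>\<mu>)"
      by (simp add: nn_integral_multc)
    also have "\<dots> \<le> (\<integral>\<^sup>+ y. ennreal (hkernel av \<Phi> m A ?f x y) \<partial>\<mu>)"
    proof (rule nn_integral_mono_AE)
      show "AE y in \<mu>. ennreal (kern y) * ennreal (vnorm av x powr ((\<alpha> + d) * l))
          \<le> ennreal (hkernel av \<Phi> m A ?f x y)"
        using AE_good
      proof eventually_elim
        case (elim y)
        then show ?case
          using hkernel_power_ge[OF elim x(1)]
          by (subst ennreal_mult[symmetric]) (auto simp: kern_nonneg intro: ennreal_leI)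
      qed
    qed
    also have "\<dots> = ennreal (?H x)"
    proof -
      have "0 \<le> hkernel av \<Phi> m A ?f x y" for y
        unfolding hkernel_def using Phi_nonneg
        by (intro mult_nonneg_nonneg divide_nonneg_nonneg prod_nonneg) auto
      then show ?thesis
        unfolding hausdorff_op_def by (intro nn_integral_eq_integral x(2) AE_I2)
    qed
    finally show ?thesis .
  qed
  \<comment> \<open>Boundedness includes absolute convergence at almost every point; a single such
    point off the origin already forces the mass of \<open>kern\<close> to be finite.\<close>
  obtain x where x: "x \<noteq> 0" "integrable \<mu> (hkernel av \<Phi> m A ?f x)"
    using AE_ex_nonzero[OF int] by blast
  have "(\<integral>\<^sup>+ y. ennreal (kern y) \<partial>\<mu>) \<noteq> top"
  proof
    assume "(\<integral>\<^sup>+ y. ennreal (kern y) \<partial>\<mu>) = top"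
    moreover have "ennreal (vnorm av x powr ((\<alpha> + d) * l)) \<noteq> 0"
      using x(1) by (simp add: ennreal_eq_0_iff not_le)
    ultimately show False
      using ge[OF x] by (simp add: ennreal_top_mult top_unique)
  qed
  then obtain T where T: "(\<integral>\<^sup>+ y. ennreal (kern y) \<partial>\<mu>) = ennreal T" "T \<ge> 0"
    by (cases "\<integral>\<^sup>+ y. ennreal (kern y) \<partial>\<mu>") auto
  define v w where "v = ball_weight d (\<alpha> + (\<alpha> + d) * l * q)" and "w = ball_weight d \<alpha>"
  have v: "v > 0"
    unfolding v_def using target_exponent by (intro ball_weight_pos) (auto simp: d)
  have w: "w > 0"
    unfolding w_def by (rule ball_weight_alpha_pos)
  have "ennreal (T powr q * v) \<le> lqball P av \<mu> weight q ?H 0"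
  proof -
    have "ennreal (T powr q * v) = ennreal (T powr q) *
        (\<integral>\<^sup>+ x\<in>pball P av 0 0. ennreal (vnorm av x powr (\<alpha> + (\<alpha> + d) * l * q)) \<partial>\<mu>)"
      using nn_integral_vnorm_powr[of "\<alpha> + (\<alpha> + d) * l * q" 0] target_exponent P_gt_1 v
      by (simp add: d v_def ennreal_mult)
    also have "\<dots> = (\<integral>\<^sup>+ x. ennreal (T powr q) *
        (ennreal (vnorm av x powr (\<alpha> + (\<alpha> + d) * l * q)) * indicator (pball P av 0 0) x) \<partial>\<mu>)"
      by (rule nn_integral_cmult[symmetric]) measurable
    also have "\<dots> \<le> lqball P av \<mu> weight q ?H 0"
      unfolding lqball_def
    proof (rule nn_integral_mono_AE)
      show "AE x in \<mu>. ennreal (T powr q) *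
          (ennreal (vnorm av x powr (\<alpha> + (\<alpha> + d) * l * q)) * indicator (pball P av 0 0) x)
          \<le> ennreal (\<bar>?H x\<bar> powr q * vnorm av x powr \<alpha>) * indicator (pball P av 0 0) x"
        using int AE_nonzero
      proof eventually_elim
        case (elim x)
        have "ennreal (T * vnorm av x powr ((\<alpha> + d) * l)) \<le> ennreal (?H x)"
          using ge[OF elim(2,1)] T by (simp add: ennreal_mult)
        then have "T * vnorm av x powr ((\<alpha> + d) * l) \<le> \<bar>?H x\<bar>"
          using T by (cases "?H x \<ge> 0") (auto simp: ennreal_le_iff ennreal_neg)
        then have "(T * vnorm av x powr ((\<alpha> + d) * l)) powr q \<le> \<bar>?H x\<bar> powr q"
          using q T by (intro powr_mono2) auto
        then have "(T * vnorm av x powr ((\<alpha> + d) * l)) powr q * vnorm av x powr \<alpha> \<le> \<bar>?H x\<bar> powr q * vnorm av x powr \<alpha>"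
          by (rule mult_right_mono) simp
        also have "(T * vnorm av x powr ((\<alpha> + d) * l)) powr q * vnorm av x powr \<alpha>
            = T powr q * vnorm av x powr (\<alpha> + (\<alpha> + d) * l * q)"
          by (simp add: powr_mult powr_powr powr_add)
        finally have "ennreal (T powr q) * ennreal (vnorm av x powr (\<alpha> + (\<alpha> + d) * l * q))
            \<le> ennreal (\<bar>?H x\<bar> powr q * vnorm av x powr \<alpha>)"
          by (subst ennreal_mult[symmetric]) (auto intro: ennreal_leI)
        then show ?case
          unfolding mult.assoc[symmetric] by (rule mult_right_mono) simp
      qed
    qed
    finally show ?thesis .
  qed
  moreover have "lqball P av \<mu> weight q ?H 0 < \<infinity>"
    using H unfolding in_morrey_def by blast
  ultimately have L: "T powr q * v \<le> enn2real (lqball P av \<mu> weight q ?H 0)"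
    using T v by (cases "lqball P av \<mu> weight q ?H 0") (auto simp: ennreal_le_iff)
  have "T * target_size = (T powr q * v / w powr (1 + l * q)) powr (1 / q)"
    using q T v w by (simp add: target_size_def powr_mult powr_divide powr_powr flip: v_def w_def)
  also have "\<dots> \<le> morrey_quot P av \<mu> weight q l ?H 0"
  proof -
    have a: "\<alpha> > - real CARD('n)"
      using alpha_pos by (simp add: d)
    have W: "wball P av \<mu> weight 0 = w"
      using P_gt_1 unfolding wball_powr[OF a] w_def d by simp
    have "- 1 - l * q = - (1 + l * q)"
      by simp
    then have "w powr (- 1 - l * q) = 1 / w powr (1 + l * q)"
      by (simp only: powr_minus_divide)
    then show ?thesis
      unfolding morrey_quot_def W using q v w L
      by (intro powr_mono2) (auto intro: divide_right_mono)
  qed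
  also have "\<dots> \<le> C * (\<Prod>i<m. morrey_norm P av \<mu> (weights i) (qs i) (ls i) (?f i))"
    using morrey_quot_le_norm[OF H] norm by (rule order_trans)
  also have "\<dots> \<le> C * (\<Prod>i<m. source_size i)"
    using power_function_morrey C0
    by (intro mult_left_mono prod_mono) (auto intro: morrey_norm_nonneg)
  finally have "T \<le> C * (\<Prod>i<m. source_size i) / target_size"
    using target_size_pos by (simp add: pos_le_divide_eq)
  then show ?thesis
    unfolding T(1) by (rule ennreal_leI)
qed

section \<open>Comparison of \<open>kern\<close> with the integrand of C_3\<close>

definition c3_integrand :: "'k^'n \<Rightarrow> real" where
  "c3_integrand y = \<Phi> y / vnorm av y ^ CARD('n) * (\<Prod>i<m. mnorm av (matrix_inv (A i y)) powr - expo i)"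

text \<open>If a and b are the norms of A_i and its inverse, then 1/a \<le> b \<le> P^\<nu>/a.
  Passing to the power -\<open>expo i\<close> costs at most P^(\<nu> |expo i|), and
  \<open>cmp_const\<close> is the product of these losses.\<close>

lemma kern_c3_compare:
  assumes "good y"
  shows "kern y \<le> cmp_const * c3_integrand y" "c3_integrand y \<le> cmp_const * kern y"
proof -
  have cmp: "mnorm av (A i y) powr expo i \<le> (real P ^ \<nu>) powr \<bar>expo i\<bar> * mnorm av (matrix_inv (A i y)) powr - expo i"
    "mnorm av (matrix_inv (A i y)) powr - expo i \<le> (real P ^ \<nu>) powr \<bar>expo i\<bar> * mnorm av (A i y) powr expo i"
    if i: "i \<in> {..<m}" for i
  proof -
    define a b where "a = mnorm av (A i y)" and "b = mnorm av (matrix_inv (A i y))"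
    have a: "a > 0"
      unfolding a_def using good_mnorm_pos[OF assms] i by simp
    have "1 \<le> b * a" "a * b \<le> real P ^ \<nu>"
      using assms i mnorm_matrix_inv[of "A i y"] by (auto simp: good_def a_def b_def)
    then have u: "0 < 1 / a" "1 / a \<le> b" "b \<le> real P ^ \<nu> * (1 / a)"
      using a by (simp_all add: field_simps)
    have "(1 / a) powr - expo i = a powr expo i"
      using a by (simp add: powr_divide powr_minus)
    then show "mnorm av (A i y) powr expo i \<le> (real P ^ \<nu>) powr \<bar>expo i\<bar> * mnorm av (matrix_inv (A i y)) powr - expo i"
      "mnorm av (matrix_inv (A i y)) powr - expo i \<le> (real P ^ \<nu>) powr \<bar>expo i\<bar> * mnorm av (A i y) powr expo i"
      using powr_comparable[OF u, of "- expo i"] unfolding a_def b_def by simp_all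
  qed
  have eq: "cmp_const * (\<Phi> y / vnorm av y ^ CARD('n) * (\<Prod>i<m. F i))
      = \<Phi> y / vnorm av y ^ CARD('n) * (\<Prod>i<m. (real P ^ \<nu>) powr \<bar>expo i\<bar> * F i)" for F
    unfolding cmp_const_def prod.distrib by (simp only: mult_ac)
  have pos: "\<Phi> y / vnorm av y ^ CARD('n) \<ge> 0"
    using Phi_nonneg by simp
  show "kern y \<le> cmp_const * c3_integrand y" "c3_integrand y \<le> cmp_const * kern y"
    unfolding kern_def c3_integrand_def eq
    by (intro mult_left_mono prod_mono conjI cmp pos; simp)+
qed

lemma kern_c3_integral:
  shows "(\<integral>\<^sup>+ y. ennreal (kern y) \<partial>\<mu>) \<le> ennreal cmp_const * (\<integral>\<^sup>+ y. ennreal (c3_integrand y) \<partial>\<mu>)"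
    and "(\<integral>\<^sup>+ y. ennreal (c3_integrand y) \<partial>\<mu>) \<le> ennreal cmp_const * (\<integral>\<^sup>+ y. ennreal (kern y) \<partial>\<mu>)"
proof -
  have "(\<integral>\<^sup>+ y. ennreal (c3_integrand y) \<partial>\<mu>) \<le> (\<integral>\<^sup>+ y. ennreal cmp_const * ennreal (kern y) \<partial>\<mu>)"
  proof (rule nn_integral_mono_AE)
    show "AE y in \<mu>. ennreal (c3_integrand y) \<le> ennreal cmp_const * ennreal (kern y)"
      using AE_good
    proof eventually_elim
      case (elim y)
      show ?case
        using kern_c3_compare(2)[OF elim] cmp_const_pos kern_nonneg[of y]
        by (subst ennreal_mult[symmetric]) (auto intro: ennreal_leI)
    qed
  qed
  also have "\<dots> = ennreal cmp_const * (\<integral>\<^sup>+ y. ennreal (kern y) \<partial>\<mu>)"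
    by (rule nn_integral_cmult) measurable
  finally show "(\<integral>\<^sup>+ y. ennreal (c3_integrand y) \<partial>\<mu>) \<le> ennreal cmp_const * (\<integral>\<^sup>+ y. ennreal (kern y) \<partial>\<mu>)" .
  \<comment> \<open>The constant is moved to the side of \<open>kern\<close> before comparing:
    pulling it out of an integral asks for a measurable integrand, and measurability has been shown
    for \<open>kern\<close> but not for \<open>c3_integrand\<close>.\<close>
  have "(\<integral>\<^sup>+ y. ennreal (kern y) \<partial>\<mu>) = (\<integral>\<^sup>+ y. ennreal cmp_const * ennreal (kern y / cmp_const) \<partial>\<mu>)"
    using cmp_const_pos by (intro nn_integral_cong) (subst ennreal_mult'[symmetric], auto)
  also have "\<dots> = ennreal cmp_const * (\<integral>\<^sup>+ y. ennreal (kern y / cmp_const) \<partial>\<mu>)"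
    by (rule nn_integral_cmult) measurable
  also have "\<dots> \<le> ennreal cmp_const * (\<integral>\<^sup>+ y. ennreal (c3_integrand y) \<partial>\<mu>)"
  proof (intro mult_left_mono nn_integral_mono_AE)
    show "AE y in \<mu>. ennreal (kern y / cmp_const) \<le> ennreal (c3_integrand y)"
      using AE_good
    proof eventually_elim
      case (elim y)
      show ?case
        using kern_c3_compare(1)[OF elim] cmp_const_pos
        by (intro ennreal_leI) (simp add: pos_divide_le_eq mult.commute)
    qed
  qed simp
  finally show "(\<integral>\<^sup>+ y. ennreal (kern y) \<partial>\<mu>) \<le> ennreal cmp_const * (\<integral>\<^sup>+ y. ennreal (c3_integrand y) \<partial>\<mu>)" .
qed

end

theorem theorem3p3:
  fixes P :: nat and av :: "'k::field \<Rightarrow> real" and \<mu> :: "('k ^ 'n) measure"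
    and m :: nat and qs :: "nat \<Rightarrow> real" and q :: real
    and \<alpha>s :: "nat \<Rightarrow> real" and \<alpha> :: real
    and ls :: "nat \<Rightarrow> real" and l :: real and \<nu> :: nat
  assumes Qp: "padic_field P av"
    and haar: "padic_haar P av \<mu>"
    and m: "m \<ge> 1"
    and q: "q \<ge> 1" and qs: "\<forall>i<m. qs i \<ge> 1"
    and alpha_gt: "\<forall>i<m. \<alpha>s i > - real CARD('n)"
    and sum_q: "(\<Sum>i<m. 1 / qs i) = 1 / q"
    and sum_alpha: "(\<Sum>i<m. \<alpha>s i / qs i) = \<alpha> / q"
    and lambdas: "\<forall>i<m. - 1 / qs i < ls i \<and> ls i < 0"
    and lambda: "(\<alpha> + real CARD('n)) * l = (\<Sum>i<m. (\<alpha>s i + real CARD('n)) * ls i)"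
  shows "\<exists>c1>0. \<exists>c2>0. \<forall>(\<Phi> :: 'k ^ 'n \<Rightarrow> real) (A :: nat \<Rightarrow> 'k ^ 'n \<Rightarrow> 'k ^ 'n ^ 'n).
     (\<Phi> \<in> borel_measurable \<mu> \<and> (\<forall>y. \<Phi> y \<ge> 0) \<and>
      (\<forall>i<m. \<forall>r s. kmeasurable P av \<mu> (\<lambda>y. A i y $ r $ s)) \<and>
      (\<forall>i<m. AE y in \<mu>. invertible (A i y)) \<and>
      (\<forall>i<m. AE y in \<mu>. mnorm av (A i y) * mnorm av (matrix_inv (A i y)) \<le> real P ^ \<nu>))
     \<longrightarrow>
     (let ws = (\<lambda>i x. vnorm av x powr \<alpha>s i);
          w = (\<lambda>x. vnorm av x powr \<alpha>);
          C3 = (\<integral>\<^sup>+ y. ennreal (\<Phi> y / vnorm av y ^ CARD('n) *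
                  (\<Prod>i<m. mnorm av (matrix_inv (A i y)) powr (- (\<alpha>s i + real CARD('n)) * ls i))) \<partial>\<mu>)
      in (hbounded P av \<mu> \<Phi> m A ws qs ls w q l \<longleftrightarrow> C3 < \<infinity>) \<and>
         (C3 < \<infinity> \<longrightarrow>
            c1 * enn2real C3 \<le> hopnorm P av \<mu> \<Phi> m A ws qs ls w q l \<and>
            hopnorm P av \<mu> \<Phi> m A ws qs ls w q l \<le> c2 * enn2real C3))"
proof -
  interpret morrey_exponents P av \<mu> m qs q \<alpha>s \<alpha> ls l \<nu> "real CARD('n)"
    using assms by unfold_locales auto
  \<comment> \<open>\<open>c1\<close> is the reciprocal of the losses in \<open>hbound_lower\<close>
    and \<open>kern_c3_integral\<close>, \<open>c2\<close> the product of those in the upper bound.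
    Neither refers to \<Phi> or A.\<close>
  define c1 c2 where "c1 = target_size / ((\<Prod>i<m. source_size i) * cmp_const)"
    and "c2 = upper_const * cmp_const"
  have S: "(\<Prod>i<m. source_size i) > 0"
    by (intro prod_pos) (auto intro: source_size_pos)
  have pos: "c1 > 0" "c2 > 0"
    using S target_size_pos upper_const_pos cmp_const_pos by (auto simp: c1_def c2_def)
  have main: "(hbounded P av \<mu> \<Phi> m A (\<lambda>i x. vnorm av x powr \<alpha>s i) qs ls (\<lambda>x. vnorm av x powr \<alpha>) q l
        \<longleftrightarrow> C3 < \<infinity>) \<and>
      (C3 < \<infinity> \<longrightarrow>
        c1 * enn2real C3 \<le> hopnorm P av \<mu> \<Phi> m A (\<lambda>i x. vnorm av x powr \<alpha>s i) qs ls (\<lambda>x. vnorm av x powr \<alpha>) q l \<and>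
        hopnorm P av \<mu> \<Phi> m A (\<lambda>i x. vnorm av x powr \<alpha>s i) qs ls (\<lambda>x. vnorm av x powr \<alpha>) q l \<le> c2 * enn2real C3)"
    if Phi: "\<Phi> \<in> borel_measurable \<mu>" "\<forall>y. \<Phi> y \<ge> 0"
      and A: "\<forall>i<m. \<forall>r s. kmeasurable P av \<mu> (\<lambda>y. A i y $ r $ s)"
        "\<forall>i<m. AE y in \<mu>. invertible (A i y)"
        "\<forall>i<m. AE y in \<mu>. mnorm av (A i y) * mnorm av (matrix_inv (A i y)) \<le> real P ^ \<nu>"
      and C3: "C3 = (\<integral>\<^sup>+ y. ennreal (\<Phi> y / vnorm av y ^ CARD('n) *
          (\<Prod>i<m. mnorm av (matrix_inv (A i y)) powr (- (\<alpha>s i + real CARD('n)) * ls i))) \<partial>\<mu>)"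
    for \<Phi> :: "'k ^ 'n \<Rightarrow> real" and A :: "nat \<Rightarrow> 'k ^ 'n \<Rightarrow> 'k ^ 'n ^ 'n" and C3
  proof -
    interpret hausdorff_kernel P av \<mu> m qs q \<alpha>s \<alpha> ls l \<nu> "real CARD('n)" \<Phi> A
      using Phi A by unfold_locales auto
    have C3_eq: "C3 = (\<integral>\<^sup>+ y. ennreal (c3_integrand y) \<partial>\<mu>)"
      unfolding C3 c3_integrand_def expo_def minus_mult_left by (rule refl)
    let ?bound = "hbound P av \<mu> \<Phi> m A weights qs ls weight q l"
    let ?norm = "hopnorm P av \<mu> \<Phi> m A weights qs ls weight q l"
    have lower: "C3 \<le> ennreal (C / c1)" if "?bound C" for C
    proof -
      have "C3 \<le> ennreal cmp_const * ennreal (C * (\<Prod>i<m. source_size i) / target_size)"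
        unfolding C3_eq using kern_c3_integral(2) hbound_lower[OF that]
        by (meson mult_left_mono order_trans zero_le)
      also have "\<dots> = ennreal (cmp_const * (C * (\<Prod>i<m. source_size i) / target_size))"
        using cmp_const_pos by (intro ennreal_mult'[symmetric]) simp
      also have "cmp_const * (C * (\<Prod>i<m. source_size i) / target_size) = C / c1"
        by (simp add: c1_def)
      finally show ?thesis .
    qed
    have fin: "(\<exists>C. ?bound C) \<and> c1 * enn2real C3 \<le> ?norm \<and> ?norm \<le> c2 * enn2real C3" if C3_fin: "C3 < \<infinity>"
    proof -
      have C3_real: "C3 = ennreal (enn2real C3)"
        using C3_fin by (simp add: less_top)
      have le: "(\<integral>\<^sup>+ y. ennreal (kern y) \<partial>\<mu>) \<le> ennreal (cmp_const * enn2real C3)"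
        using kern_c3_integral(1) cmp_const_pos C3_real unfolding C3_eq by (simp add: ennreal_mult)
      then obtain T where T: "(\<integral>\<^sup>+ y. ennreal (kern y) \<partial>\<mu>) = ennreal T" "T \<ge> 0"
        by (cases "\<integral>\<^sup>+ y. ennreal (kern y) \<partial>\<mu>") (auto simp: top_unique)
      have T_le: "T \<le> cmp_const * enn2real C3"
        using le cmp_const_pos unfolding T(1) by (simp add: ennreal_le_iff)
      have bound: "?bound (upper_const * T)"
        by (rule hbound_upper[OF T])
      have upper: "upper_const * T \<le> c2 * enn2real C3"
        using mult_left_mono[OF T_le, of upper_const] upper_const_pos by (simp add: c2_def mult.assoc)
      \<comment> \<open>\<open>hbound\<close> contains C \<ge> 0, so the admissible constants are
        bounded below and their infimum is a genuine one.\<close>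
      have "?norm \<le> upper_const * T"
        unfolding hopnorm_def using bound
        by (intro cInf_lower) (auto simp: hbound_def intro!: bdd_belowI[of _ 0])
      moreover have "c1 * enn2real C3 \<le> ?norm"
        unfolding hopnorm_def
      proof (rule cInf_greatest)
        show "{C. ?bound C} \<noteq> {}"
          using bound by blast
        fix C assume "C \<in> {C. ?bound C}"
        then have C: "?bound C"
          by simp
        then have "C \<ge> 0"
          by (simp add: hbound_def)
        then have "enn2real C3 \<le> C / c1"
          using lower[OF C] pos by (subst (asm) C3_real) (simp add: ennreal_le_iff)
        then show "c1 * enn2real C3 \<le> C"
          using pos by (simp add: pos_le_divide_eq mult.commute)
      qed
      ultimately show ?thesis
        using upper bound by auto
    qed
    show ?thesis
    proof (intro conjI iffI impI)
      assume "hbounded P av \<mu> \<Phi> m A weights qs ls weight q l"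
      then obtain C where "?bound C"
        unfolding hbounded_def by blast
      then show "C3 < \<infinity>"
        using lower le_less_trans by fastforce
    next
      assume "C3 < \<infinity>"
      then show "hbounded P av \<mu> \<Phi> m A weights qs ls weight q l"
        unfolding hbounded_def using fin by blast
    qed (use fin in simp_all)
  qed
  show ?thesis
    using pos main by (intro exI[of _ c1] exI[of _ c2] conjI allI impI) (auto simp: Let_def)
qed

end
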